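(* Let $\mathbf{B}$ be a finite relational structure whose universe $B$ has size $n\ge2$, and suppose that the set of polymorphisms of $\mathbf{B}$ is diagonal-cautious. Then there exist a finite set $D$ and an encoding $F$ for $\mathbf{B}$ over $D$, all of whose elements have arity at most $1$, such that: (i) $\mathbf{B}$ is $F$-stable; and (ii) there is a surjective map $f_x: D\to B$ in $F$ such that for every relation $Q\subseteq B^k$ of $\mathbf{B}$, the relation $\bigcup_{(b_1,\dots,b_k)\in Q}\big(f_x^{-1}(b_1)\times\cdots\times f_x^{-1}(b_k)\big)\subseteq D^k$ is an $F$-induced relation of $\mathbf{B}$. Consequently, $\mathsf{CSP}(\mathbf{B}^* )$ polynomial-time many-one reduces to $\mathsf{SCSP}(\mathbf{B})$.
   Context: Structures have a finite signature of relation symbols with arities and a finite universe. A $\wedge$-formula is a conjunction of atoms $R(v_1,\dots,v_k)$ and variable equalities with the usual satisfaction. $\mathsf{CSP}(\mathbf{A})$: given a $\wedge$-formula over the signature of $\mathbf{A}$, decide whether it has a satisfying assignment into the universe of $\mathbf{A}$. $\mathsf{SCSP}(\mathbf{B})$: given a finite variable set $U$ and a $\wedge$-formula $\phi$ with variables from $U$, decide whether some surjective $U\to B$ satisfies $\phi$. Enumerate $B=\{b_1^*,\dots,b_n^*\}$; $\mathbf{B}^*$ is $\mathbf{B}$ expanded by the unary relations $\{(b_i^* )\}$ for each $i$. A polymorphism of $\mathbf{B}$ is a total operation $p: B^J\to B$ ($J$ finite) such that for every relation $R^{\mathbf{B}}$ of arity $k$ and every choice of tuples $r_j\in R^{\mathbf{B}}$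 ($j\in J$), the tuple $(p((r_j(1))_j),\dots,p((r_j(k))_j))$ is in $R^{\mathbf{B}}$. The diagonal of $f:B^J\to B$ is $\hat f(b)=f(b^J)$, where $b^J$ is the constant map with value $b$. A set $\mathcal{O}$ of operations on $B$ is diagonal-cautious if there is a map $G: B^n\to\wp(B)$ such that (a) for each $f\in \mathcal{O}$, the image of $f$ is contained in $G(\hat f(b_1^* ),\dots,\hat f(b_n^* ))$, and (b) for each $(b_1,\dots,b_n)\in B^n$ with $\{b_1,\dots,b_n\}\neq B$, $G(b_1,\dots,b_n)\neq B$. For a finite set $S$, a set of maps $S\to B$ is $\wedge$-definable if it is the set of satisfying assignments $S\to B$ of a $\wedge$-formula with variables from $S$; $\langle T\rangle_{\mathbf{B}}$ is the smallest $\wedge$-definable set containing $T$. An automorphism is a bijection of $B$ preserving each relation in both directions. A set $T$ of maps $I\to B$ is surjectively closed if every surjective map in $\langle T\rangle_{\mathbf{B}}$ equals $\gamma\circ t$, $\gamma$ an automorphism, $t\in T$. An encoding over a finite set $D$: a finite set $F$ of maps $f: D^k\to B$ ($k\ge0$ the arity; $D^0=\{\text{empty tuple}\}$). For a finite set $V$: $G_{V,D}$ = maps $V\to D$; a $(V,F)$-application is $(\bar v,f)$ with $f\in F$ and $\bar v$ a tuple over $V$ of length the arity of $f$; $A_{V,F}$ the set of them; $\alpha[g]=f(g(v_1),\dots,g(v_k))$ for $\alpha=((v_1,\dots,v_k),f)$; $t[g]:\alpha\mapsto\alpha[g]$; $T_V=\{t[g]\mid g\in G_{V,D}\}$. $\mathbf{B}$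 is $F$-stable if for every non-empty finite $V$, every map in $T_V$ is surjective and $T_V$ is surjectively closed. An $F$-induced relation is $Q'\subseteq D^s$ ($s\ge1$) such that, for pairwise distinct variables $U=\{u_1,\dots,u_s\}$, there are $Q\subseteq B^r$ (a relation of $\mathbf{B}$ or equality on $B$) and $(\alpha_1,\dots,\alpha_r)\in A_{U,F}^r$ with $Q'=\{(g(u_1),\dots,g(u_s))\mid g\in G_{U,D},\ (t[g](\alpha_1),\dots,t[g](\alpha_r))\in Q\}$. *)

theory Defs
  imports Main "HOL-Library.FuncSet" "HOL-Computational_Algebra.Polynomial"
begin

section \<open>Structures and conjunctive formulas\<close>

text \<open>
  Tuples are lists. The relation symbols of a structure are the indices into the list
  \<open>rels\<close>; each entry is an arity together with the relation interpreting that symbol.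
\<close>

definition tuples :: "nat \<Rightarrow> 'a set \<Rightarrow> 'a list set" where
  "tuples k A = {xs. length xs = k \<and> set xs \<subseteq> A}"

record 'b struct =
  univ :: "'b set"
  rels :: "(nat \<times> 'b list set) list"

text \<open>
  Arities are positive, in accordance with induced relations being
  subsets of \<open>D\<^sup>s\<close> with \<open>s \<ge> 1\<close>.
\<close>

definition finite_struct :: "'b struct \<Rightarrow> bool" where
  "finite_struct B \<longleftrightarrow>
     finite (univ B) \<and> (\<forall>(k, R) \<in> set (rels B). k \<ge> 1 \<and> R \<subseteq> tuples k (univ B))"

definition expand_constants :: "'b struct \<Rightarrow> 'b list \<Rightarrow> 'b struct" where
  "expand_constants B bs = B\<lparr>rels := rels B @ map (\<lambda>b. (1, {[b]})) bs\<rparr>"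

datatype 'v atom = Rel nat "'v list" | Eq 'v 'v

type_synonym 'v formula = "'v atom list"

fun wf_atom :: "'b struct \<Rightarrow> 'v atom \<Rightarrow> bool" where
  "wf_atom B (Rel i vs) \<longleftrightarrow> i < length (rels B) \<and> length vs = fst (rels B ! i)"
| "wf_atom B (Eq u v) \<longleftrightarrow> True"

definition wf_formula :: "'b struct \<Rightarrow> 'v formula \<Rightarrow> bool" where
  "wf_formula B \<phi> \<longleftrightarrow> (\<forall>a \<in> set \<phi>. wf_atom B a)"

definition vars :: "'v formula \<Rightarrow> 'v set" where
  "vars \<phi> = (\<Union>a \<in> set \<phi>. set_atom a)"

fun satisfies_atom :: "'b struct \<Rightarrow> ('v \<Rightarrow> 'b) \<Rightarrow> 'v atom \<Rightarrow> bool" where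
  "satisfies_atom B h (Rel i vs) \<longleftrightarrow> map h vs \<in> snd (rels B ! i)"
| "satisfies_atom B h (Eq u v) \<longleftrightarrow> h u = h v"

definition satisfies :: "'b struct \<Rightarrow> ('v \<Rightarrow> 'b) \<Rightarrow> 'v formula \<Rightarrow> bool" where
  "satisfies B h \<phi> \<longleftrightarrow> (\<forall>a \<in> set \<phi>. satisfies_atom B h a)"


section \<open>Polymorphisms and diagonal-cautious sets of operations\<close>

text \<open>
  An operation \<open>p : B\<^sup>J \<rightarrow> B\<close> is represented by the pair \<open>(J, p)\<close>. The finite index set
  \<open>J\<close> is taken among the sets of natural numbers, and \<open>B\<^sup>J\<close> is \<open>J \<rightarrow>\<^sub>E B\<close>.
\<close>

type_synonym 'b operation = "nat set \<times> ((nat \<Rightarrow> 'b) \<Rightarrow> 'b)"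

definition polymorphisms :: "'b struct \<Rightarrow> 'b operation set" where
  "polymorphisms B =
     {(J, p). finite J \<and> p \<in> (J \<rightarrow>\<^sub>E univ B) \<rightarrow> univ B \<and>
        (\<forall>(k, R) \<in> set (rels B). \<forall>r \<in> J \<rightarrow> R. map (\<lambda>i. p (\<lambda>j\<in>J. r j ! i)) [0..<k] \<in> R)}"

fun diagonal :: "'b operation \<Rightarrow> 'b \<Rightarrow> 'b" where
  "diagonal (J, p) b = p (\<lambda>j\<in>J. b)"

fun image_of :: "'b set \<Rightarrow> 'b operation \<Rightarrow> 'b set" where
  "image_of A (J, p) = p ` (J \<rightarrow>\<^sub>E A)"

text \<open>The list \<open>bs\<close> is the enumeration \<open>b\<^sub>1\<^sup>*, \<dots>, b\<^sub>n\<^sup>*\<close> of the set \<open>A\<close>.\<close>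

definition diagonal_cautious :: "'b set \<Rightarrow> 'b list \<Rightarrow> 'b operation set \<Rightarrow> bool" where
  "diagonal_cautious A bs Ops \<longleftrightarrow>
     (\<exists>G \<in> tuples (length bs) A \<rightarrow> Pow A.
        (\<forall>f \<in> Ops. image_of A f \<subseteq> G (map (diagonal f) bs)) \<and>
        (\<forall>xs \<in> tuples (length bs) A. set xs \<noteq> A \<longrightarrow> G xs \<noteq> A))"


section \<open>Definable sets, surjective closure\<close>

definition wedge_definable :: "'b struct \<Rightarrow> 's set \<Rightarrow> ('s \<Rightarrow> 'b) set \<Rightarrow> bool" where
  "wedge_definable B S X \<longleftrightarrow>
     (\<exists>\<phi>. wf_formula B \<phi> \<and> vars \<phi> \<subseteq> S \<and> X = {h \<in> S \<rightarrow>\<^sub>E univ B. satisfies B h \<phi>})"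

definition wedge_span :: "'b struct \<Rightarrow> 's set \<Rightarrow> ('s \<Rightarrow> 'b) set \<Rightarrow> ('s \<Rightarrow> 'b) set" where
  "wedge_span B S T = \<Inter>{X. wedge_definable B S X \<and> T \<subseteq> X}"

text \<open>
  For finite \<open>S\<close> and \<open>B\<close> this intersection is itself definable, hence it is the smallest
  definable set containing \<open>T\<close>.
\<close>

lemma wedge_definable_UNIV: "wedge_definable B S (S \<rightarrow>\<^sub>E univ B)"
  unfolding wedge_definable_def
  by (rule exI[of _ "[]"]) (auto simp: wf_formula_def vars_def satisfies_def)

lemma wedge_definable_Int:
  assumes "wedge_definable B S X" "wedge_definable B S Y"
  shows "wedge_definable B S (X \<inter> Y)"
proof -
  from assms obtain \<phi> \<psi> where
    "wf_formula B \<phi>" "vars \<phi> \<subseteq> S" "X = {h \<in> S \<rightarrow>\<^sub>E univ B. satisfies B h \<phi>}"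
    "wf_formula B \<psi>" "vars \<psi> \<subseteq> S" "Y = {h \<in> S \<rightarrow>\<^sub>E univ B. satisfies B h \<psi>}"
    unfolding wedge_definable_def by blast
  then show ?thesis
    unfolding wedge_definable_def
    by (intro exI[of _ "\<phi> @ \<psi>"]) (auto simp: wf_formula_def vars_def satisfies_def)
qed

lemma wedge_span_smallest:
  assumes "finite S" "finite (univ B)" "T \<subseteq> S \<rightarrow>\<^sub>E univ B"
  shows "wedge_definable B S (wedge_span B S T)" "T \<subseteq> wedge_span B S T"
    and "wedge_definable B S X \<Longrightarrow> T \<subseteq> X \<Longrightarrow> wedge_span B S T \<subseteq> X"
proof -
  let ?C = "{X. wedge_definable B S X \<and> T \<subseteq> X}"
  have "?C \<subseteq> Pow (S \<rightarrow>\<^sub>E univ B)"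
    by (auto simp: wedge_definable_def)
  then have fin: "finite ?C"
    using assms by (meson finite_PiE finite_Pow_iff finite_subset)
  have ne: "?C \<noteq> {}"
    using wedge_definable_UNIV[of B S] assms(3) by blast
  have "wedge_definable B S (\<Inter>C)" if "finite C" "C \<noteq> {}" "C \<subseteq> ?C" for C
    using that by (induction C rule: finite_ne_induct) (auto intro: wedge_definable_Int)
  from this[OF fin ne] show "wedge_definable B S (wedge_span B S T)"
    by (simp add: wedge_span_def)
qed (auto simp: wedge_span_def)

definition automorphism :: "'b struct \<Rightarrow> ('b \<Rightarrow> 'b) \<Rightarrow> bool" where
  "automorphism B \<gamma> \<longleftrightarrow>
     bij_betw \<gamma> (univ B) (univ B) \<and>
     (\<forall>(k, R) \<in> set (rels B). \<forall>xs \<in> tuples k (univ B). xs \<in> R \<longleftrightarrow> map \<gamma> xs \<in> R)"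

definition surjectively_closed :: "'b struct \<Rightarrow> 's set \<Rightarrow> ('s \<Rightarrow> 'b) set \<Rightarrow> bool" where
  "surjectively_closed B I T \<longleftrightarrow>
     (\<forall>h \<in> wedge_span B I T. h ` I = univ B \<longrightarrow>
        (\<exists>\<gamma> t. automorphism B \<gamma> \<and> t \<in> T \<and> h = (\<lambda>i\<in>I. \<gamma> (t i))))"


section \<open>Encodings, stability, induced relations\<close>

text \<open>
  A map \<open>f : D\<^sup>k \<rightarrow> B\<close> is the pair \<open>(k, f)\<close> with \<open>f\<close> extensional on \<open>D\<^sup>k\<close>, so that
  equality of pairs is equality of maps.
\<close>

type_synonym ('d, 'b) emap = "nat \<times> ('d list \<Rightarrow> 'b)"

definition encoding :: "'b struct \<Rightarrow> 'd set \<Rightarrow> ('d, 'b) emap set \<Rightarrow> bool" where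
  "encoding B D F \<longleftrightarrow> finite F \<and> (\<forall>(k, f) \<in> F. f \<in> tuples k D \<rightarrow>\<^sub>E univ B)"

text \<open>Variables are bit strings.\<close>

type_synonym var = "bool list"

type_synonym ('v, 'd, 'b) application = "'v list \<times> ('d, 'b) emap"

definition applications :: "'v set \<Rightarrow> ('d, 'b) emap set \<Rightarrow> ('v, 'd, 'b) application set" where
  "applications V F = {(vs, (k, f)). (k, f) \<in> F \<and> vs \<in> tuples k V}"

fun app_value :: "('v \<Rightarrow> 'd) \<Rightarrow> ('v, 'd, 'b) application \<Rightarrow> 'b" where
  "app_value g (vs, (k, f)) = f (map g vs)"

definition t_map ::
  "'v set \<Rightarrow> ('d, 'b) emap set \<Rightarrow> ('v \<Rightarrow> 'd) \<Rightarrow> ('v, 'd, 'b) application \<Rightarrow> 'b" where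
  "t_map V F g = (\<lambda>\<alpha> \<in> applications V F. app_value g \<alpha>)"

definition T_set ::
  "'v set \<Rightarrow> 'd set \<Rightarrow> ('d, 'b) emap set \<Rightarrow> (('v, 'd, 'b) application \<Rightarrow> 'b) set" where
  "T_set V D F = t_map V F ` (V \<rightarrow>\<^sub>E D)"

definition F_stable :: "'b struct \<Rightarrow> 'd set \<Rightarrow> ('d, 'b) emap set \<Rightarrow> bool" where
  "F_stable B D F \<longleftrightarrow>
     (\<forall>V :: var set. finite V \<and> V \<noteq> {} \<longrightarrow>
        (\<forall>t \<in> T_set V D F. t ` applications V F = univ B) \<and>
        surjectively_closed B (applications V F) (T_set V D F))"

definition F_induced ::
  "'b struct \<Rightarrow> 'd set \<Rightarrow> ('d, 'b) emap set \<Rightarrow> nat \<Rightarrow> 'd list set \<Rightarrow> bool" where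
  "F_induced B D F s Q' \<longleftrightarrow>
     s \<ge> 1 \<and> Q' \<subseteq> tuples s D \<and>
     (\<forall>us :: var list. length us = s \<and> distinct us \<longrightarrow>
        (\<exists>r Q \<alpha>s. ((r, Q) \<in> set (rels B) \<or> r = 2 \<and> Q = {[b, b] |b. b \<in> univ B}) \<and>
           \<alpha>s \<in> tuples r (applications (set us) F) \<and>
           Q' = {map g us |g. g \<in> set us \<rightarrow>\<^sub>E D \<and> map (t_map (set us) F g) \<alpha>s \<in> Q}))"


section \<open>Polynomial-time many-one reductions\<close>

text \<open>
  Deterministic multi-tape Turing machines. Tapes are two-way infinite; symbol \<open>0\<close> is the
  blank. The running states are the numbers below \<open>states M\<close>, state \<open>0\<close> is initial, and the
  number \<open>states M\<close> is the halting state. Input is on tape \<open>0\<close>, output on tape \<open>1\<close>.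
\<close>

datatype dir = MoveLeft | Stay | MoveRight

fun offset :: "dir \<Rightarrow> int" where
  "offset MoveLeft = -1"
| "offset Stay = 0"
| "offset MoveRight = 1"

record tm =
  tapes :: nat
  states :: nat
  symbols :: nat
  delta :: "nat \<Rightarrow> nat list \<Rightarrow> nat \<times> (nat \<times> dir) list"

definition wf_tm :: "tm \<Rightarrow> bool" where
  "wf_tm M \<longleftrightarrow> tapes M \<ge> 2 \<and> symbols M \<ge> 1 \<and>
     (\<forall>s < states M. \<forall>rs \<in> tuples (tapes M) {..<symbols M}.
        case delta M s rs of (s', as) \<Rightarrow>
          s' \<le> states M \<and> length as = tapes M \<and> (\<forall>(w, d) \<in> set as. w < symbols M))"

type_synonym tape = "(int \<Rightarrow> nat) \<times> int"

type_synonym config = "nat \<times> tape list"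

fun read_tape :: "tape \<Rightarrow> nat" where
  "read_tape (t, h) = t h"

fun act_tape :: "nat \<times> dir \<Rightarrow> tape \<Rightarrow> tape" where
  "act_tape (w, d) (t, h) = (t(h := w), h + offset d)"

fun step :: "tm \<Rightarrow> config \<Rightarrow> config" where
  "step M (s, ts) =
     (if s < states M
      then (case delta M s (map read_tape ts) of (s', as) \<Rightarrow> (s', map2 act_tape as ts))
      else (s, ts))"

definition contents :: "nat list \<Rightarrow> int \<Rightarrow> nat" where
  "contents w = (\<lambda>i. if 0 \<le> i \<and> i < int (length w) then w ! nat i else 0)"

definition init_config :: "tm \<Rightarrow> nat list \<Rightarrow> config" where
  "init_config M w = (0, (contents w, 0) # replicate (tapes M - 1) (contents [], 0))"

definition computes_within :: "tm \<Rightarrow> nat list \<Rightarrow> nat list \<Rightarrow> nat \<Rightarrow> bool" where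
  "computes_within M w v m \<longleftrightarrow>
     (\<exists>j \<le> m. case (step M ^^ j) (init_config M w) of (s, ts) \<Rightarrow>
        s = states M \<and> fst (ts ! 1) = contents v)"

text \<open>
  A decision problem consists of its instances, its yes-instances, and a representation of
  instances as words over a finite alphabet of positive numbers.
\<close>

record 'i problem =
  instances :: "'i set"
  yes :: "'i set"
  encode :: "'i \<Rightarrow> nat list"

text \<open>
  Input letters have to belong to the alphabet of the machine: the transition function is
  only a finite table on tuples of tape symbols below \<open>symbols M\<close>.
\<close>

definition polytime_computable ::
  "'i set \<Rightarrow> ('i \<Rightarrow> nat list) \<Rightarrow> ('j \<Rightarrow> nat list) \<Rightarrow> ('i \<Rightarrow> 'j) \<Rightarrow> bool" where
  "polytime_computable I enc enc' f \<longleftrightarrow>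
     (\<exists>M (p :: nat poly). wf_tm M \<and>
        (\<forall>x \<in> I. set (enc x) \<subseteq> {1..<symbols M} \<and>
           computes_within M (enc x) (enc' (f x)) (poly p (length (enc x)))))"

definition polytime_reducible :: "'i problem \<Rightarrow> 'j problem \<Rightarrow> bool" where
  "polytime_reducible P P' \<longleftrightarrow>
     (\<exists>f. polytime_computable (instances P) (encode P) (encode P') f \<and>
        (\<forall>x \<in> instances P. f x \<in> instances P' \<and> (x \<in> yes P \<longleftrightarrow> f x \<in> yes P')))"


section \<open>The problems CSP and SCSP\<close>

text \<open>
  Letters \<open>1\<close> and \<open>2\<close> are the bits, \<open>3\<close> terminates a variable or a relation symbol, \<open>4\<close> and
  \<open>5\<close> start a relational atom and an equality, and \<open>6\<close> separates the list of variables of an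
  SCSP instance from its formula. The relation symbol with index \<open>i\<close> is written in unary; as
  the signature is fixed, this affects the length of instances by a constant factor only.
\<close>

definition encode_var :: "var \<Rightarrow> nat list" where
  "encode_var v = map (\<lambda>b. if b then 2 else 1) v @ [3]"

fun encode_atom :: "var atom \<Rightarrow> nat list" where
  "encode_atom (Rel i vs) = [4] @ replicate i 1 @ [3] @ concat (map encode_var vs)"
| "encode_atom (Eq u v) = [5] @ encode_var u @ encode_var v"

definition encode_formula :: "var formula \<Rightarrow> nat list" where
  "encode_formula \<phi> = concat (map encode_atom \<phi>)"

fun encode_instance :: "var list \<times> var formula \<Rightarrow> nat list" where
  "encode_instance (us, \<phi>) = concat (map encode_var us) @ [6] @ encode_formula \<phi>"

text \<open>Distinct instances have distinct representations.\<close>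

lemma encode_var_append:
  "encode_var u @ xs = encode_var v @ ys \<Longrightarrow> u = v \<and> xs = ys"
proof (induction u arbitrary: v)
  case Nil
  then show ?case by (cases v) (auto simp: encode_var_def split: if_splits)
next
  case (Cons b u)
  show ?case
  proof (cases v)
    case Nil
    then show ?thesis using Cons.prems by (auto simp: encode_var_def split: if_splits)
  next
    case (Cons c v')
    with Cons.prems have "b = c" "encode_var u @ xs = encode_var v' @ ys"
      by (auto simp: encode_var_def split: if_splits)
    then show ?thesis using Cons.IH Cons by blast
  qed
qed

lemma encode_var_first: "\<exists>a w. encode_var v = a # w \<and> a < 4"
  by (cases v) (auto simp: encode_var_def)

lemma encode_vars_append:
  assumes "concat (map encode_var us) @ xs = concat (map encode_var vs) @ ys"
    and "xs = [] \<or> hd xs \<ge> 4" "ys = [] \<or> hd ys \<ge> 4"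
  shows "us = vs \<and> xs = ys"
  using assms
proof (induction us arbitrary: vs)
  case Nil
  then show ?case
    using encode_var_first[of "hd vs"] by (cases vs) (auto simp: neq_Nil_conv)
next
  case (Cons u us)
  show ?case
  proof (cases vs)
    case Nil
    then show ?thesis
      using Cons.prems encode_var_first[of u] by (auto simp: neq_Nil_conv)
  next
    case (Cons v vs')
    then have "encode_var u @ (concat (map encode_var us) @ xs) =
        encode_var v @ (concat (map encode_var vs') @ ys)"
      using Cons.prems(1) by simp
    from encode_var_append[OF this] show ?thesis
      using Cons.IH[of vs'] Cons.prems Cons by blast
  qed
qed

lemma replicate_append_3:
  "replicate i (1 :: nat) @ 3 # xs = replicate j 1 @ 3 # ys \<Longrightarrow> i = j \<and> xs = ys"
proof (induction i arbitrary: j)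
  case 0
  then show ?case by (cases j) auto
next
  case (Suc i)
  then show ?case by (cases j) auto
qed

lemma encode_atom_append:
  assumes "encode_atom a @ xs = encode_atom b @ ys"
    and "xs = [] \<or> hd xs \<ge> 4" "ys = [] \<or> hd ys \<ge> 4"
  shows "a = b \<and> xs = ys"
proof (cases a; cases b)
  fix i us j vs assume ab: "a = Rel i us" "b = Rel j vs"
  then have "i = j \<and> concat (map encode_var us) @ xs = concat (map encode_var vs) @ ys"
    using assms(1) by (intro replicate_append_3) simp
  with encode_vars_append[of us xs vs ys] ab assms(2,3) show ?thesis by blast
next
  fix u v u' v' assume ab: "a = Eq u v" "b = Eq u' v'"
  then have "encode_var u @ (encode_var v @ xs) = encode_var u' @ (encode_var v' @ ys)"
    using assms(1) by simp
  with encode_var_append ab show ?thesis by blast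
qed (use assms(1) in auto)

lemma encode_formula_first: "encode_formula \<phi> = [] \<or> hd (encode_formula \<phi>) \<ge> 4"
proof (cases \<phi>)
  case (Cons a \<psi>)
  then show ?thesis by (cases a) (auto simp: encode_formula_def)
qed (simp add: encode_formula_def)

lemma inj_encode_formula: "inj encode_formula"
proof
  fix \<phi> \<psi>
  assume "encode_formula \<phi> = encode_formula \<psi>"
  then show "\<phi> = \<psi>"
  proof (induction \<phi> arbitrary: \<psi>)
    case Nil
    then show ?case
      by (cases \<psi>; cases "hd \<psi>") (auto simp: encode_formula_def)
  next
    case (Cons a \<phi>)
    show ?case
    proof (cases \<psi>)
      case Nil
      then show ?thesis using Cons.prems by (cases a) (auto simp: encode_formula_def)
    next
      case (Cons b \<psi>')
      then have "encode_atom a @ encode_formula \<phi> = encode_atom b @ encode_formula \<psi>'"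
        using Cons.prems by (simp add: encode_formula_def)
      from encode_atom_append[OF this encode_formula_first encode_formula_first]
      show ?thesis using Cons.IH Cons by blast
    qed
  qed
qed

lemma inj_encode_instance: "inj encode_instance"
proof
  fix x y
  assume eq: "encode_instance x = encode_instance y"
  obtain us \<phi> vs \<psi> where xy: "x = (us, \<phi>)" "y = (vs, \<psi>)"
    by (metis surj_pair)
  with eq have "us = vs \<and> 6 # encode_formula \<phi> = 6 # encode_formula \<psi>"
    by (intro encode_vars_append) auto
  then show "x = y"
    using xy inj_encode_formula by (simp add: inj_eq)
qed

definition CSP :: "'b struct \<Rightarrow> var formula problem" where
  "CSP B =
     \<lparr>instances = {\<phi>. wf_formula B \<phi>},
      yes = {\<phi>. wf_formula B \<phi> \<and> (\<exists>h \<in> vars \<phi> \<rightarrow> univ B. satisfies B h \<phi>)},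
      encode = encode_formula\<rparr>"

text \<open>The finite variable set \<open>U\<close> is given as a list of its elements, possibly with repetitions.\<close>

definition SCSP :: "'b struct \<Rightarrow> (var list \<times> var formula) problem" where
  "SCSP B =
     \<lparr>instances = {(us, \<phi>). wf_formula B \<phi> \<and> vars \<phi> \<subseteq> set us},
      yes = {(us, \<phi>). wf_formula B \<phi> \<and> vars \<phi> \<subseteq> set us \<and>
               (\<exists>h. h ` set us = univ B \<and> satisfies B h \<phi>)},
      encode = encode_instance\<rparr>"

end

theory Submission
  imports Defs
begin

text \<open>
  Take for \<open>D\<close> the idempotent \<open>n\<close>-ary polymorphisms and for \<open>F\<close> the evaluations
  \<open>d \<mapsto> d x\<close> at the points \<open>x \<in> B\<^sup>n\<close>; the map \<open>f\<^sub>x\<close> is the evaluation at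
  \<open>(b\<^sub>1, \<dots>, b\<^sub>n)\<close>, which is onto because \<open>D\<close> contains the projections. A map \<open>h\<close> in the
  closure of \<open>T\<^sub>V\<close> satisfies all conjunctive conditions true of \<open>T\<^sub>V\<close>; hence for each variable
  \<open>v\<close> the function \<open>x \<mapsto> h (v, x)\<close> is a total polymorphism, and all of these have the same
  diagonal \<open>c\<close>. If \<open>h\<close> is onto, diagonal-cautiousness forces \<open>c\<close> to be a permutation, hence
  an automorphism, and \<open>c\<^sup>-\<^sup>1 \<circ> h\<close> consists of idempotent polymorphisms, so it lies in \<open>T\<^sub>V\<close>.

  The same argument shows that an instance of the CSP is equivalent to the conjunction of the
  atoms that make \<open>x \<mapsto> (v, x)\<close> a polymorphism for each \<open>v\<close>, of equalities forcing a common
  diagonal, and of the original atoms on the variables \<open>(v, (b\<^sub>1, \<dots>, b\<^sub>n))\<close>. Every variable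
  contributes a fixed template, so that a two-way finite transducer can write this instance.
\<close>

section \<open>The encoding by idempotent polymorphisms\<close>

lemma tuples_Suc_0: "tuples (Suc 0) A = (\<lambda>a. [a]) ` A"
  by (auto simp: tuples_def length_Suc_conv)

lemma finite_tuples: "finite A \<Longrightarrow> finite (tuples k A)"
  using finite_lists_length_eq[of A k] by (simp add: tuples_def conj_commute)

lemma finite_extensional_funcset:
  assumes "finite A" "finite C"
  shows "finite (A \<rightarrow>\<^sub>E C)"
  using assms by (simp add: finite_PiE)

lemma finite_struct_rel:
  assumes "finite_struct B" "(k, R) \<in> set (rels B)"
  shows "1 \<le> k" "R \<subseteq> tuples k (univ B)" "finite R"
proof -
  show "1 \<le> k" "R \<subseteq> tuples k (univ B)"
    using assms by (auto simp: finite_struct_def)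
  then show "finite R"
    using assms finite_tuples finite_subset by (metis finite_struct_def)
qed

lemma satisfies_atom_map: "satisfies_atom B h (map_atom f a) \<longleftrightarrow> satisfies_atom B (h \<circ> f) a"
  by (cases a) simp_all

lemma satisfies_atom_cong:
  "(\<And>v. v \<in> set_atom a \<Longrightarrow> h v = h' v) \<Longrightarrow> satisfies_atom B h a \<longleftrightarrow> satisfies_atom B h' a"
  by (cases a) (simp_all cong: map_cong)

lemma wf_atom_map: "wf_atom B (map_atom f a) \<longleftrightarrow> wf_atom B a"
  by (cases a) simp_all

text \<open>Relational atoms use that an automorphism preserves relations in both directions;
  equalities use its injectivity. The values of \<open>h\<close> must lie in the universe because
  \<open>\<gamma>\<close> is controlled only there.\<close>

lemma automorphism_satisfies_atom:
  assumes "automorphism B \<gamma>" "wf_atom B a" "\<And>v. v \<in> set_atom a \<Longrightarrow> h v \<in> univ B"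
  shows "satisfies_atom B (\<gamma> \<circ> h) a \<longleftrightarrow> satisfies_atom B h a"
proof (cases a)
  case (Rel i vs)
  obtain k R where kR: "rels B ! i = (k, R)" by fastforce
  then have "(k, R) \<in> set (rels B)" "length vs = k"
    using assms(2) Rel by (metis nth_mem wf_atom.simps(1), simp)
  moreover have "map h vs \<in> tuples k (univ B)"
    using assms(3) Rel \<open>length vs = k\<close> by (auto simp: tuples_def)
  ultimately have "map h vs \<in> R \<longleftrightarrow> map \<gamma> (map h vs) \<in> R"
    using assms(1) unfolding automorphism_def by blast
  then show ?thesis using Rel kR by simp
next
  case (Eq u v)
  then show ?thesis
    using assms by (auto simp: automorphism_def bij_betw_def inj_on_def)
qed

section \<open>Polymorphisms as solutions of finitely many atoms\<close>

text \<open>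
  These atoms, over the variable set \<open>B\<^sup>n\<close>, say that an assignment is a polymorphism.
\<close>

definition poly_atoms :: "'b struct \<Rightarrow> nat \<Rightarrow> (nat \<Rightarrow> 'b) atom set" where
  "poly_atoms B n =
     (\<Union>i < length (rels B).
        (\<lambda>r. Rel i (map (\<lambda>l. \<lambda>j\<in>{..<n}. r j ! l) [0..<fst (rels B ! i)])) `
          ({..<n} \<rightarrow>\<^sub>E snd (rels B ! i)))"

text \<open>Indexing by extensional families \<open>r\<close> leaves finitely many choices.
  Finiteness is what later permits listing these atoms in a formula.\<close>

lemma finite_poly_atoms:
  assumes "finite_struct B"
  shows "finite (poly_atoms B n)"
  unfolding poly_atoms_def
proof (intro finite_UN_I finite_imageI finite_extensional_funcset finite_lessThan)
  fix i assume "i \<in> {..<length (rels B)}"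
  then have "(fst (rels B ! i), snd (rels B ! i)) \<in> set (rels B)" by simp
  with assms show "finite (snd (rels B ! i))" by (rule finite_struct_rel(3))
qed

lemma poly_atoms_wf:
  assumes "finite_struct B" "a \<in> poly_atoms B n"
  shows "wf_atom B a" "set_atom a \<subseteq> {..<n} \<rightarrow>\<^sub>E univ B"
proof -
  from assms(2) obtain i r where a: "i < length (rels B)" "r \<in> {..<n} \<rightarrow>\<^sub>E snd (rels B ! i)"
    "a = Rel i (map (\<lambda>l. \<lambda>j\<in>{..<n}. r j ! l) [0..<fst (rels B ! i)])"
    unfolding poly_atoms_def by blast
  then show "wf_atom B a" by simp
  have "snd (rels B ! i) \<subseteq> tuples (fst (rels B ! i)) (univ B)"
    using finite_struct_rel(2)[OF assms(1)] a(1) by (metis nth_mem prod.collapse)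
  then have "r j ! l \<in> univ B" if "j < n" "l < fst (rels B ! i)" for j l
    using that a(2) by (fastforce simp: tuples_def PiE_iff)
  then have "(\<lambda>j\<in>{..<n}. r j ! l) \<in> {..<n} \<rightarrow>\<^sub>E univ B" if "l < fst (rels B ! i)" for l
    using that by (simp add: restrict_PiE_iff)
  then show "set_atom a \<subseteq> {..<n} \<rightarrow>\<^sub>E univ B"
    unfolding a(3) by (simp add: image_subset_iff)
qed

text \<open>A family \<open>r\<close> of rows gives one atom, whose variables are the columns of
  \<open>r\<close>. The definition of a polymorphism ranges over arbitrary functions
  \<open>r\<close>, so the converse first restricts \<open>r\<close> to the index set, which leaves
  the columns unchanged.\<close>

lemma polymorphism_iff_poly_atoms:
  assumes "p \<in> ({..<n} \<rightarrow>\<^sub>E univ B) \<rightarrow> univ B"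
  shows "({..<n}, p) \<in> polymorphisms B \<longleftrightarrow> (\<forall>a \<in> poly_atoms B n. satisfies_atom B p a)"
proof
  assume "({..<n}, p) \<in> polymorphisms B"
  then have pres: "\<forall>(k, R) \<in> set (rels B). \<forall>r \<in> {..<n} \<rightarrow> R. map (\<lambda>i. p (\<lambda>j\<in>{..<n}. r j ! i)) [0..<k] \<in> R"
    by (simp add: polymorphisms_def)
  have "map (\<lambda>l. p (\<lambda>j\<in>{..<n}. r j ! l)) [0..<fst (rels B ! i)] \<in> snd (rels B ! i)"
    if "i < length (rels B)" "r \<in> {..<n} \<rightarrow>\<^sub>E snd (rels B ! i)" for i r
  proof -
    have "r \<in> {..<n} \<rightarrow> snd (rels B ! i)"
      using that(2) by (simp add: PiE_iff Pi_iff)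
    then show ?thesis
      using bspec[OF pres nth_mem[OF that(1)]] by (simp add: case_prod_unfold)
  qed
  then show "\<forall>a \<in> poly_atoms B n. satisfies_atom B p a"
    by (auto simp: poly_atoms_def comp_def)
next
  assume sat: "\<forall>a \<in> poly_atoms B n. satisfies_atom B p a"
  have "map (\<lambda>i. p (\<lambda>j\<in>{..<n}. r j ! i)) [0..<k] \<in> R"
    if kR: "(k, R) \<in> set (rels B)" and r: "r \<in> {..<n} \<rightarrow> R" for k R r
  proof -
    from kR obtain i where i: "i < length (rels B)" "rels B ! i = (k, R)"
      by (auto simp: in_set_conv_nth)
    have r': "restrict r {..<n} \<in> {..<n} \<rightarrow>\<^sub>E snd (rels B ! i)"
      unfolding restrict_PiE_iff using r i by (simp add: Pi_iff)
    have "Rel i (map (\<lambda>l. \<lambda>j\<in>{..<n}. restrict r {..<n} j ! l) [0..<k]) \<in> poly_atoms B n"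
      unfolding poly_atoms_def using i by (intro UN_I[of i] image_eqI[OF _ r']) simp_all
    from bspec[OF sat this] i have "map (\<lambda>l. p (\<lambda>j\<in>{..<n}. restrict r {..<n} j ! l)) [0..<k] \<in> R"
      by (simp add: comp_def)
    moreover have "(\<lambda>j\<in>{..<n}. restrict r {..<n} j ! l) = (\<lambda>j\<in>{..<n}. r j ! l)" for l
      by auto
    ultimately show ?thesis by simp
  qed
  with assms show "({..<n}, p) \<in> polymorphisms B"
    by (auto simp: polymorphisms_def)
qed

section \<open>Families of polymorphisms with a common diagonal\<close>

text \<open>
  A family of polymorphisms with a common diagonal that jointly hit every element cannot have
  a non-surjective diagonal: all images would lie in one proper subset \<open>G (\<dots>)\<close>.
\<close>

lemma common_diagonal_automorphism:
  assumes fs: "finite_struct B" and bs: "set bs = univ B"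
    and cautious: "diagonal_cautious (univ B) bs (polymorphisms B)"
    and poly: "\<And>v. v \<in> I \<Longrightarrow> ({..<n}, p v) \<in> polymorphisms B"
    and diag: "\<And>v b. v \<in> I \<Longrightarrow> b \<in> univ B \<Longrightarrow> p v (\<lambda>j\<in>{..<n}. b) = c b"
    and cover: "univ B \<subseteq> (\<Union>v\<in>I. p v ` ({..<n} \<rightarrow>\<^sub>E univ B))"
    and ne: "I \<noteq> {}"
  shows "automorphism B c"
proof -
  from cautious obtain G where G: "G \<in> tuples (length bs) (univ B) \<rightarrow> Pow (univ B)"
    "\<forall>f \<in> polymorphisms B. image_of (univ B) f \<subseteq> G (map (diagonal f) bs)"
    "\<forall>xs \<in> tuples (length bs) (univ B). set xs \<noteq> univ B \<longrightarrow> G xs \<noteq> univ B"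
    unfolding diagonal_cautious_def by blast
  from ne obtain v where v: "v \<in> I" by blast
  have "p v \<in> ({..<n} \<rightarrow>\<^sub>E univ B) \<rightarrow> univ B"
    using poly[OF v] by (simp add: polymorphisms_def)
  then have "p v (\<lambda>j\<in>{..<n}. b) \<in> univ B" if "b \<in> univ B" for b
    by (rule funcset_mem) (simp add: that)
  then have cB: "c ` univ B \<subseteq> univ B"
    using diag[OF v] by auto
  \<comment> \<open>All members have the same diagonal tuple, so one and the same set
    \<open>G (map c bs)\<close> bounds all their images.\<close>
  have "map (diagonal ({..<n}, p u)) bs = map c bs" if "u \<in> I" for u
    using diag[OF that] bs by simp
  then have "p u ` ({..<n} \<rightarrow>\<^sub>E univ B) \<subseteq> G (map c bs)" if "u \<in> I" for u
    using bspec[OF G(2) poly[OF that]] that by (metis image_of.simps)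
  then have "univ B \<subseteq> G (map c bs)"
    using cover by blast
  moreover have tup: "map c bs \<in> tuples (length bs) (univ B)"
    using bs cB by (auto simp: tuples_def)
  ultimately have "G (map c bs) = univ B"
    using G(1) by blast
  with G(3) tup have "set (map c bs) = univ B"
    by blast
  then have onto: "c ` univ B = univ B"
    using bs by simp
  have "finite (univ B)"
    using fs by (simp add: finite_struct_def)
  with onto have inj: "inj_on c (univ B)"
    by (simp add: eq_card_imp_inj_on)
  have pres: "map c xs \<in> R" if "(k, R) \<in> set (rels B)" "xs \<in> R" for k R xs
  proof -
    have "xs \<in> tuples k (univ B)"
      using finite_struct_rel[OF fs that(1)] that(2) by blast
    then have xs: "length xs = k" "set xs \<subseteq> univ B"
      by (auto simp: tuples_def)
    have "\<forall>r \<in> {..<n} \<rightarrow> R. map (\<lambda>i. p v (\<lambda>j\<in>{..<n}. r j ! i)) [0..<k] \<in> R"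
      using poly[OF v] that(1) by (auto simp: polymorphisms_def)
    \<comment> \<open>Feeding the constant family of rows \<open>xs\<close> to the polymorphism
      applies \<open>c\<close> to each entry of \<open>xs\<close>.\<close>
    from bspec[OF this, of "\<lambda>_. xs"] that(2)
    have "map (\<lambda>i. p v (\<lambda>j\<in>{..<n}. xs ! i)) [0..<k] \<in> R"
      by simp
    moreover have "map (\<lambda>i. p v (\<lambda>j\<in>{..<n}. xs ! i)) [0..<k] = map c xs"
      using xs diag[OF v] by (intro nth_equalityI) (auto simp: subset_iff)
    ultimately show ?thesis by simp
  qed
  have "xs \<in> R \<longleftrightarrow> map c xs \<in> R"
    if kR: "(k, R) \<in> set (rels B)" and xs: "xs \<in> tuples k (univ B)" for k R xs
  proof
    assume mem: "map c xs \<in> R"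
    have R: "R \<subseteq> tuples k (univ B)" "finite R"
      using finite_struct_rel[OF fs kR] by auto
    have lists: "tuples k (univ B) \<subseteq> lists (univ B)"
      by (auto simp: tuples_def)
    have inj_map: "inj_on (map c) (tuples k (univ B))"
      using inj_on_subset[OF inj_on_map_lists[OF inj] lists] .
    \<comment> \<open>An injective self-map of the finite relation is onto, which turns preservation
      into the reverse implication.\<close>
    have "map c ` R = R"
      using R pres[OF kR] inj_on_subset[OF inj_map] by (intro card_subset_eq) (auto simp: card_image)
    with mem obtain ys where "ys \<in> R" "map c xs = map c ys" by blast
    with inj_map xs R show "xs \<in> R"
      by (metis inj_on_eq_iff subsetD)
  qed (rule pres[OF kR])
  with inj onto show ?thesis
    by (auto simp: automorphism_def bij_betw_def)
qed

section \<open>Idempotent polymorphisms\<close>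

text \<open>Extensionality makes each operation a single element of a finite set, so that these
  operations can be numbered.\<close>

definition idem_polys :: "'b struct \<Rightarrow> nat \<Rightarrow> ((nat \<Rightarrow> 'b) \<Rightarrow> 'b) set" where
  "idem_polys B n =
     {d \<in> ({..<n} \<rightarrow>\<^sub>E univ B) \<rightarrow>\<^sub>E univ B.
        ({..<n}, d) \<in> polymorphisms B \<and> (\<forall>b \<in> univ B. d (\<lambda>j\<in>{..<n}. b) = b)}"

lemma idem_polysI:
  assumes d: "d \<in> ({..<n} \<rightarrow>\<^sub>E univ B) \<rightarrow>\<^sub>E univ B"
    and "\<And>a. a \<in> poly_atoms B n \<Longrightarrow> satisfies_atom B d a"
    and "\<And>b. b \<in> univ B \<Longrightarrow> d (\<lambda>j\<in>{..<n}. b) = b"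
  shows "d \<in> idem_polys B n"
proof -
  have "d \<in> ({..<n} \<rightarrow>\<^sub>E univ B) \<rightarrow> univ B"
    using d by (simp add: PiE_iff[of d] Pi_iff[of d])
  with assms show ?thesis
    unfolding idem_polys_def by (simp add: polymorphism_iff_poly_atoms)
qed

lemma idem_polysD:
  assumes "d \<in> idem_polys B n"
  shows "({..<n}, d) \<in> polymorphisms B"
    and "x \<in> {..<n} \<rightarrow>\<^sub>E univ B \<Longrightarrow> d x \<in> univ B"
    and "b \<in> univ B \<Longrightarrow> d (\<lambda>j\<in>{..<n}. b) = b"
    and "a \<in> poly_atoms B n \<Longrightarrow> satisfies_atom B d a"
proof -
  have d: "d \<in> ({..<n} \<rightarrow>\<^sub>E univ B) \<rightarrow>\<^sub>E univ B" and poly: "({..<n}, d) \<in> polymorphisms B"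
    and diag: "\<forall>b \<in> univ B. d (\<lambda>j\<in>{..<n}. b) = b"
    using assms unfolding idem_polys_def by simp_all
  have d': "d \<in> ({..<n} \<rightarrow>\<^sub>E univ B) \<rightarrow> univ B"
    using d by (simp add: PiE_iff[of d] Pi_iff[of d])
  show "({..<n}, d) \<in> polymorphisms B" by (rule poly)
  show "d x \<in> univ B" if "x \<in> {..<n} \<rightarrow>\<^sub>E univ B"
    using PiE_mem[OF d that] .
  show "d (\<lambda>j\<in>{..<n}. b) = b" if "b \<in> univ B"
    using diag that by blast
  show "satisfies_atom B d a" if "a \<in> poly_atoms B n"
    using poly that polymorphism_iff_poly_atoms[OF d'] by blast
qed

lemma finite_idem_polys:
  assumes "finite (univ B)"
  shows "finite (idem_polys B n)"
proof (rule finite_subset)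
  show "idem_polys B n \<subseteq> ({..<n} \<rightarrow>\<^sub>E univ B) \<rightarrow>\<^sub>E univ B"
    unfolding idem_polys_def by (rule Collect_restrict)
  show "finite (({..<n} \<rightarrow>\<^sub>E univ B) \<rightarrow>\<^sub>E univ B)"
    by (intro finite_extensional_funcset finite_lessThan assms)
qed

text \<open>Projections preserve every relation because they return one of the given rows. They make
  the evaluation at the enumeration onto, and they supply the assignments in the completeness half
  of the reduction.\<close>

lemma projection_idem_poly:
  assumes "finite_struct B" "i < n"
  shows "(\<lambda>x\<in>{..<n} \<rightarrow>\<^sub>E univ B. x i) \<in> idem_polys B n"
proof -
  let ?p = "\<lambda>x\<in>{..<n} \<rightarrow>\<^sub>E univ B. x i"
  have p: "?p \<in> ({..<n} \<rightarrow>\<^sub>E univ B) \<rightarrow>\<^sub>E univ B"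
    unfolding restrict_PiE_iff using assms(2) by (blast intro: PiE_mem)
  have sat: "satisfies_atom B ?p a" if a: "a \<in> poly_atoms B n" for a
  proof -
    from a obtain l r where l: "l < length (rels B)" "r \<in> {..<n} \<rightarrow>\<^sub>E snd (rels B ! l)"
      "a = Rel l (map (\<lambda>l. \<lambda>j\<in>{..<n}. r j ! l) [0..<fst (rels B ! l)])"
      unfolding poly_atoms_def by blast
    have "r i \<in> snd (rels B ! l)"
      using l(2) assms(2) by auto
    moreover from this have "length (r i) = fst (rels B ! l)"
      using finite_struct_rel(2)[OF assms(1), of "fst (rels B ! l)" "snd (rels B ! l)"] l(1)
      by (auto simp: tuples_def)
    moreover have "map (\<lambda>x. x i) (map (\<lambda>l. \<lambda>j\<in>{..<n}. r j ! l) [0..<length (r i)]) = r i"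
      using assms(2) by (simp add: comp_def map_nth)
    ultimately have "satisfies_atom B (\<lambda>x. x i) a"
      using l(3) by simp
    moreover have "satisfies_atom B ?p a \<longleftrightarrow> satisfies_atom B (\<lambda>x. x i) a"
      using poly_atoms_wf(2)[OF assms(1) a] by (intro satisfies_atom_cong) auto
    ultimately show ?thesis by simp
  qed
  show ?thesis
    by (rule idem_polysI[OF p sat]) (simp_all add: assms(2))
qed

text \<open>The witness is the inverse of \<open>c\<close> composed with \<open>p\<close>: an
  inverse automorphism keeps all atoms true, and it cancels the diagonal \<open>c\<close>.\<close>

lemma automorphism_inverse_idem_poly:
  assumes fs: "finite_struct B" and aut: "automorphism B c"
    and poly: "({..<n}, p) \<in> polymorphisms B"
    and diag: "\<And>b. b \<in> univ B \<Longrightarrow> p (\<lambda>j\<in>{..<n}. b) = c b"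
  obtains d where "d \<in> idem_polys B n" "\<And>x. x \<in> {..<n} \<rightarrow>\<^sub>E univ B \<Longrightarrow> p x = c (d x)"
proof -
  define d where "d = (\<lambda>x\<in>{..<n} \<rightarrow>\<^sub>E univ B. inv_into (univ B) c (p x))"
  have bij: "bij_betw c (univ B) (univ B)"
    using aut by (simp add: automorphism_def)
  have p: "p \<in> ({..<n} \<rightarrow>\<^sub>E univ B) \<rightarrow> univ B"
    using poly by (simp add: polymorphisms_def)
  then have p_univ: "p x \<in> univ B" if "x \<in> {..<n} \<rightarrow>\<^sub>E univ B" for x
    using that by (rule funcset_mem)
  then have c_d: "p x = c (d x)" if "x \<in> {..<n} \<rightarrow>\<^sub>E univ B" for x
    using that bij by (simp add: d_def bij_betw_inv_into_right)
  have d: "d \<in> ({..<n} \<rightarrow>\<^sub>E univ B) \<rightarrow>\<^sub>E univ B"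
    using p_univ bij_betwE[OF bij_betw_inv_into[OF bij]]
    unfolding d_def restrict_PiE_iff by blast
  have sat: "satisfies_atom B d a" if a: "a \<in> poly_atoms B n" for a
  proof -
    note wf = poly_atoms_wf[OF fs a]
    have "satisfies_atom B p a"
      using poly polymorphism_iff_poly_atoms[OF p] a by blast
    moreover have "satisfies_atom B p a \<longleftrightarrow> satisfies_atom B (c \<circ> d) a"
    proof (rule satisfies_atom_cong)
      fix x assume "x \<in> set_atom a"
      then show "p x = (c \<circ> d) x" using c_d[of x] wf(2) by (simp add: subsetD)
    qed
    moreover have "satisfies_atom B (c \<circ> d) a \<longleftrightarrow> satisfies_atom B d a"
    proof (rule automorphism_satisfies_atom[OF aut wf(1)])
      fix x assume "x \<in> set_atom a"
      then show "d x \<in> univ B" using PiE_mem[OF d, of x] wf(2) by (simp add: subsetD)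
    qed
    ultimately show ?thesis by simp
  qed
  have diag_d: "d (\<lambda>j\<in>{..<n}. b) = b" if "b \<in> univ B" for b
    using that bij by (simp add: d_def diag bij_betw_inv_into_left)
  have "d \<in> idem_polys B n"
    by (rule idem_polysI[OF d sat diag_d])
  then show ?thesis
    using c_d that by blast
qed

section \<open>Evaluation maps and stability\<close>

text \<open>The elements of \<open>D\<close> are names of operations and \<open>dec\<close> recovers
  the operation. This lets \<open>D\<close> be a set of natural numbers.\<close>

definition eval_map :: "'d set \<Rightarrow> ('d \<Rightarrow> (nat \<Rightarrow> 'b) \<Rightarrow> 'b) \<Rightarrow> (nat \<Rightarrow> 'b) \<Rightarrow> 'd list \<Rightarrow> 'b" where
  "eval_map D dec x = (\<lambda>ds\<in>tuples 1 D. dec (hd ds) x)"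

definition eval_encoding ::
  "'b struct \<Rightarrow> nat \<Rightarrow> 'd set \<Rightarrow> ('d \<Rightarrow> (nat \<Rightarrow> 'b) \<Rightarrow> 'b) \<Rightarrow> ('d, 'b) emap set" where
  "eval_encoding B n D dec = (\<lambda>x. (1, eval_map D dec x)) ` ({..<n} \<rightarrow>\<^sub>E univ B)"

lemma eval_map_singleton: "d \<in> D \<Longrightarrow> eval_map D dec x [d] = dec d x"
  by (simp add: eval_map_def tuples_def)

lemma applications_unary:
  "applications V ((\<lambda>x. (1, e x)) ` X) = (\<lambda>(v, x). ([v], (1, e x))) ` (V \<times> X)"
  by (force simp: applications_def tuples_Suc_0)

lemma applications_eval_encoding:
  "applications V (eval_encoding B n D dec) =
     (\<lambda>(v, x). ([v], (1, eval_map D dec x))) ` (V \<times> ({..<n} \<rightarrow>\<^sub>E univ B))"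
  unfolding eval_encoding_def by (rule applications_unary)

lemma encoding_eval_encoding:
  assumes "finite (univ B)" "dec ` D \<subseteq> idem_polys B n"
  shows "encoding B D (eval_encoding B n D dec)"
proof -
  have "dec d x \<in> univ B" if "d \<in> D" "x \<in> {..<n} \<rightarrow>\<^sub>E univ B" for d x
    using assms(2) that by (intro idem_polysD(2)[of _ B n]) auto
  then have "eval_map D dec x \<in> tuples 1 D \<rightarrow>\<^sub>E univ B" if "x \<in> {..<n} \<rightarrow>\<^sub>E univ B" for x
    using that unfolding eval_map_def restrict_PiE_iff by (auto simp: tuples_Suc_0)
  moreover have "finite ({..<n} \<rightarrow>\<^sub>E univ B)"
    using assms(1) by (simp add: finite_extensional_funcset)
  ultimately show ?thesis
    by (auto simp only: encoding_def eval_encoding_def finite_imageI)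
qed

text \<open>The solutions of the single atom \<open>a\<close> form a definable set containing
  \<open>T\<close>, so this set takes part in the intersection that defines the span.\<close>

lemma wedge_span_satisfies_atom:
  assumes "h \<in> wedge_span B S T" "T \<subseteq> S \<rightarrow>\<^sub>E univ B"
    and "wf_atom B a" "set_atom a \<subseteq> S" "\<And>t. t \<in> T \<Longrightarrow> satisfies_atom B t a"
  shows "satisfies_atom B h a"
proof -
  have "wedge_definable B S {h \<in> S \<rightarrow>\<^sub>E univ B. satisfies B h [a]}"
    unfolding wedge_definable_def using assms(3,4)
    by (intro exI[of _ "[a]"]) (auto simp: wf_formula_def vars_def)
  moreover have "T \<subseteq> {h \<in> S \<rightarrow>\<^sub>E univ B. satisfies B h [a]}"
    using assms(2,5) by (simp add: satisfies_def subset_iff)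
  ultimately have "h \<in> {h \<in> S \<rightarrow>\<^sub>E univ B. satisfies B h [a]}"
    using assms(1) unfolding wedge_span_def by blast
  then show ?thesis by (simp add: satisfies_def)
qed

lemma F_stable_eval_encoding:
  fixes dec :: "'d \<Rightarrow> (nat \<Rightarrow> 'b) \<Rightarrow> 'b"
  assumes fs: "finite_struct B" and bs: "set bs = univ B"
    and cautious: "diagonal_cautious (univ B) bs (polymorphisms B)"
    and dec: "bij_betw dec D (idem_polys B n)"
  shows "F_stable B D (eval_encoding B n D dec)"
  unfolding F_stable_def
proof (intro allI impI conjI)
  fix V :: "var set" assume V: "finite V \<and> V \<noteq> {}"
  let ?X = "{..<n} \<rightarrow>\<^sub>E univ B" and ?F = "eval_encoding B n D dec"
  let ?A = "applications V ?F" and ?T = "T_set V D ?F"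
  \<comment> \<open>An application amounts to a variable and a point of \<open>B^n\<close>, so a map
    on applications yields one \<open>n\<close>-ary function for each variable.\<close>
  define app :: "var \<Rightarrow> (nat \<Rightarrow> 'b) \<Rightarrow> (var, 'd, 'b) application"
    where "app v x = ([v], (1, eval_map D dec x))" for v x
  have A: "?A = {app v x |v x. v \<in> V \<and> x \<in> ?X}"
    by (auto simp: applications_eval_encoding app_def)
  have app_mem: "app v x \<in> ?A" if "v \<in> V" "x \<in> ?X" for v x
    using that A by blast
  have t_app: "t_map V ?F g (app v x) = dec (g v) x" if "v \<in> V" "x \<in> ?X" "g \<in> V \<rightarrow>\<^sub>E D" for g v x
  proof -
    have "t_map V ?F g (app v x) = app_value g (app v x)"
      using app_mem[OF that(1,2)] by (simp add: t_map_def)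
    also have "\<dots> = dec (g v) x"
      using PiE_mem[OF that(3,1)] by (simp add: app_def eval_map_singleton)
    finally show ?thesis .
  qed
  have dec_g: "dec (g v) \<in> idem_polys B n" if "v \<in> V" "g \<in> V \<rightarrow>\<^sub>E D" for g v
    using that dec by (auto dest: bij_betwE)
  have T_ext: "?T \<subseteq> ?A \<rightarrow>\<^sub>E univ B"
  proof
    fix t assume "t \<in> ?T"
    then obtain g where g: "g \<in> V \<rightarrow>\<^sub>E D" "t = t_map V ?F g"
      by (auto simp: T_set_def)
    have "t \<alpha> \<in> univ B" if "\<alpha> \<in> ?A" for \<alpha>
    proof -
      from that A obtain v x where "\<alpha> = app v x" "v \<in> V" "x \<in> ?X" by blast
      with g t_app[OF _ _ g(1)] idem_polysD(2)[OF dec_g[OF _ g(1)]] show ?thesis by simp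
    qed
    then show "t \<in> ?A \<rightarrow>\<^sub>E univ B"
      using g(2) by (auto simp: t_map_def)
  qed
  show "\<forall>t \<in> ?T. t ` ?A = univ B"
  proof (intro ballI equalityI)
    fix t assume t: "t \<in> ?T"
    then show "t ` ?A \<subseteq> univ B" using T_ext by auto
    from t obtain g where g: "g \<in> V \<rightarrow>\<^sub>E D" "t = t_map V ?F g"
      by (auto simp: T_set_def)
    from V obtain v where v: "v \<in> V" by blast
    \<comment> \<open>By idempotence, each \<open>b\<close> is already attained at the constant
      tuple with value \<open>b\<close>.\<close>
    show "univ B \<subseteq> t ` ?A"
    proof
      fix b assume b: "b \<in> univ B"
      then have x: "(\<lambda>j\<in>{..<n}. b) \<in> ?X" by simp
      have "t (app v (\<lambda>j\<in>{..<n}. b)) = b"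
        using t_app[OF v x g(1)] dec_g[OF v g(1)] g(2) b by (simp add: idem_polysD(3))
      then show "b \<in> t ` ?A" using app_mem[OF v x] by (metis image_eqI)
    qed
  qed
  show "surjectively_closed B ?A ?T"
    unfolding surjectively_closed_def
  proof (intro ballI impI)
    fix h assume h: "h \<in> wedge_span B ?A ?T" and onto: "h ` ?A = univ B"
    note sat = wedge_span_satisfies_atom[OF h T_ext]
    have h_ext: "h \<in> ?A \<rightarrow>\<^sub>E univ B"
      using h T_ext wedge_definable_UNIV[of B ?A] unfolding wedge_span_def by blast
    \<comment> \<open>Copied to the variable \<open>v\<close>, each polymorphism atom holds for all
      of \<open>T_V\<close>, since every \<open>dec (g v)\<close> is a polymorphism; hence it holds
      for \<open>h\<close>.\<close>
    have poly: "({..<n}, h \<circ> app v) \<in> polymorphisms B" if v: "v \<in> V" for v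
    proof -
      have "satisfies_atom B (h \<circ> app v) a" if a: "a \<in> poly_atoms B n" for a
      proof -
        have "satisfies_atom B h (map_atom (app v) a)"
        proof (rule sat)
          show "wf_atom B (map_atom (app v) a)"
            using poly_atoms_wf[OF fs a] by (simp add: wf_atom_map)
          show "set_atom (map_atom (app v) a) \<subseteq> ?A"
            unfolding atom.set_map using poly_atoms_wf(2)[OF fs a] app_mem[OF v] by blast
          fix t assume "t \<in> ?T"
          then obtain g where g: "g \<in> V \<rightarrow>\<^sub>E D" "t = t_map V ?F g"
            by (auto simp: T_set_def)
          have "satisfies_atom B (t \<circ> app v) a \<longleftrightarrow> satisfies_atom B (dec (g v)) a"
          proof (rule satisfies_atom_cong)
            fix x assume "x \<in> set_atom a"
            then show "(t \<circ> app v) x = dec (g v) x"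
              using subsetD[OF poly_atoms_wf(2)[OF fs a]] t_app[OF v _ g(1)] g(2) by simp
          qed
          moreover have "satisfies_atom B (dec (g v)) a"
            using idem_polysD(4)[OF dec_g[OF v g(1)] a] .
          ultimately show "satisfies_atom B t (map_atom (app v) a)"
            by (simp add: satisfies_atom_map)
        qed
        then show ?thesis by (simp add: satisfies_atom_map)
      qed
      moreover have "h \<circ> app v \<in> ?X \<rightarrow> univ B"
        using PiE_mem[OF h_ext app_mem[OF v]] by (intro funcsetI) simp
      ultimately show ?thesis
        by (simp add: polymorphism_iff_poly_atoms)
    qed
    from V obtain v\<^sub>0 where v\<^sub>0: "v\<^sub>0 \<in> V" by blast
    \<comment> \<open>At a constant tuple all members of \<open>T_V\<close> give the same value for
      every variable. These equalities pass to \<open>h\<close>, so the choice of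
      \<open>v\<^sub>0\<close> is immaterial.\<close>
    define c where "c b = h (app v\<^sub>0 (\<lambda>j\<in>{..<n}. b))" for b
    have diag: "(h \<circ> app v) (\<lambda>j\<in>{..<n}. b) = c b" if v: "v \<in> V" and b: "b \<in> univ B" for v b
    proof -
      let ?x = "\<lambda>j\<in>{..<n}. b"
      have x: "?x \<in> ?X" using b by simp
      have "satisfies_atom B h (Eq (app v ?x) (app v\<^sub>0 ?x))"
      proof (rule sat)
        show "set_atom (Eq (app v ?x) (app v\<^sub>0 ?x)) \<subseteq> ?A"
          using app_mem[OF v x] app_mem[OF v\<^sub>0 x] by simp
        fix t assume "t \<in> ?T"
        then obtain g where g: "g \<in> V \<rightarrow>\<^sub>E D" "t = t_map V ?F g"
          by (auto simp: T_set_def)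
        then show "satisfies_atom B t (Eq (app v ?x) (app v\<^sub>0 ?x))"
          using t_app[OF v x g(1)] t_app[OF v\<^sub>0 x g(1)] dec_g[OF v g(1)] dec_g[OF v\<^sub>0 g(1)] b
          by (simp add: idem_polysD(3))
      qed simp
      then show ?thesis by (simp add: c_def)
    qed
    have cover: "univ B \<subseteq> (\<Union>v\<in>V. (h \<circ> app v) ` ?X)"
    proof
      fix b assume "b \<in> univ B"
      then have "b \<in> h ` ?A" using onto by simp
      then obtain \<alpha> where \<alpha>: "\<alpha> \<in> ?A" "b = h \<alpha>" by (rule imageE)
      with A obtain v x where "v \<in> V" "x \<in> ?X" "\<alpha> = app v x" by blast
      with \<alpha> have "v \<in> V" "x \<in> ?X" "b = h (app v x)" by simp_all
      then show "b \<in> (\<Union>v\<in>V. (h \<circ> app v) ` ?X)"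
        by (intro UN_I[of v] image_eqI[of _ _ x]) simp_all
    qed
    have "V \<noteq> {}" using V by blast
    with fs bs cautious poly diag cover have aut: "automorphism B c"
      by (rule common_diagonal_automorphism)
    have "\<exists>e \<in> D. \<forall>x \<in> ?X. h (app v x) = c (dec e x)" if v: "v \<in> V" for v
    proof -
      obtain d where d: "d \<in> idem_polys B n" "\<And>x. x \<in> ?X \<Longrightarrow> (h \<circ> app v) x = c (d x)"
        using automorphism_inverse_idem_poly[OF fs aut poly[OF v] diag[OF v]] by metis
      with dec obtain e where "e \<in> D" "dec e = d"
        by (metis bij_betw_imp_surj_on imageE)
      with d(2) show ?thesis by auto
    qed
    \<comment> \<open>Naming, for each variable, the idempotent polymorphism obtained by undoing
      \<open>c\<close> gives the assignment that produces \<open>h\<close> up to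
      \<open>c\<close>.\<close>
    then obtain g where g: "\<forall>v \<in> V. g v \<in> D \<and> (\<forall>x \<in> ?X. h (app v x) = c (dec (g v) x))"
      by metis
    let ?g = "restrict g V"
    have gV: "?g \<in> V \<rightarrow>\<^sub>E D" using g by auto
    have "h = (\<lambda>i\<in>?A. c (t_map V ?F ?g i))"
    proof
      fix i
      show "h i = (\<lambda>i\<in>?A. c (t_map V ?F ?g i)) i"
      proof (cases "i \<in> ?A")
        case True
        then obtain v x where i: "i = app v x" and vx: "v \<in> V" "x \<in> ?X" using A by blast
        have "h (app v x) = c (dec (g v) x)" using g vx by blast
        with True i vx(1) t_app[OF vx gV] show ?thesis by simp
      next
        case False
        with PiE_arb[OF h_ext] show ?thesis by simp
      qed
    qed
    with aut gV show "\<exists>\<gamma> t. automorphism B \<gamma> \<and> t \<in> ?T \<and> h = (\<lambda>i\<in>?A. \<gamma> (t i))"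
      unfolding T_set_def by blast
  qed
qed

section \<open>Induced relations and existence of the encoding\<close>

lemma listset_preimages:
  "xs \<in> listset (map (\<lambda>b. {d \<in> D. f d = b}) q) \<longleftrightarrow> set xs \<subseteq> D \<and> map f xs = q"
  by (induction q arbitrary: xs) (auto simp: set_Cons_def)

text \<open>The relation is induced through \<open>Q\<close> itself, with the single map
  \<open>f\<close> applied to each of the variables in turn.\<close>

lemma F_induced_preimages:
  assumes fs: "finite_struct B" and kQ: "(k, Q) \<in> set (rels B)" and f: "(1, f) \<in> F"
  shows "F_induced B D F k (\<Union>q \<in> Q. listset (map (\<lambda>b. {d \<in> D. f [d] = b}) q))" (is "F_induced B D F k ?Q'")
proof -
  have Q: "1 \<le> k" "Q \<subseteq> tuples k (univ B)"
    using finite_struct_rel[OF fs kQ] by auto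
  have mem: "xs \<in> ?Q' \<longleftrightarrow> set xs \<subseteq> D \<and> map (\<lambda>d. f [d]) xs \<in> Q" for xs
    by (auto simp: listset_preimages)
  have eq: "?Q' = {map g us |g. g \<in> set us \<rightarrow>\<^sub>E D \<and>
      map (t_map (set us) F g) (map (\<lambda>u. ([u], (1, f))) us) \<in> Q}"
    if us: "length us = k" "distinct us" for us :: "var list"
  proof -
    have t: "map (t_map (set us) F g) (map (\<lambda>u. ([u], (1, f))) us) = map (\<lambda>d. f [d]) (map g us)" for g
      using f by (auto simp: t_map_def applications_def tuples_def)
    \<comment> \<open>Distinctness of the variables allows any tuple over \<open>D\<close> to be
      prescribed as their values.\<close>
    have ex: "\<exists>g. xs = map g us \<and> g \<in> set us \<rightarrow>\<^sub>E D" if "length xs = k" "set xs \<subseteq> D" for xs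
    proof (intro exI conjI)
      let ?g = "restrict (the \<circ> map_of (zip us xs)) (set us)"
      show xs: "xs = map ?g us"
        using us that by (intro nth_equalityI) (auto simp: map_of_zip_nth)
      show "?g \<in> set us \<rightarrow>\<^sub>E D"
        using that(2) arg_cong[OF xs, of set] by (simp only: set_map restrict_PiE_iff) auto
    qed
    have len: "length xs = k" if "map (\<lambda>d. f [d]) xs \<in> Q" for xs
      using that Q(2) by (auto simp: tuples_def)
    have "xs \<in> ?Q' \<longleftrightarrow> (\<exists>g. xs = map g us \<and> g \<in> set us \<rightarrow>\<^sub>E D \<and> map (\<lambda>d. f [d]) (map g us) \<in> Q)" (is "?L \<longleftrightarrow> ?R")
      for xs
    proof
      assume ?L
      then have "set xs \<subseteq> D" "map (\<lambda>d. f [d]) xs \<in> Q" by (simp_all only: mem)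
      with ex[OF len] show ?R by metis
    next
      assume ?R
      then show ?L unfolding mem by (auto dest: PiE_mem)
    qed
    then show ?thesis
      unfolding t by (intro set_eqI) (simp only: mem_Collect_eq)
  qed
  have apps: "map (\<lambda>u. ([u], (1, f))) us \<in> tuples k (applications (set us) F)"
    if "length us = k" for us :: "var list"
    using that f by (auto simp: tuples_def applications_def)
  have "?Q' \<subseteq> tuples k D"
    using Q(2) by (auto simp: listset_preimages tuples_def)
  then show ?thesis
    using Q(1) unfolding F_induced_def
  proof (intro conjI allI impI)
    fix us :: "var list" assume "length us = k \<and> distinct us"
    with eq[of us] apps[of us] kQ show "\<exists>r Q0 \<alpha>s. ((r, Q0) \<in> set (rels B) \<or> r = 2 \<and> Q0 = {[b, b] |b. b \<in> univ B}) \<and>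
        \<alpha>s \<in> tuples r (applications (set us) F) \<and>
        ?Q' = {map g us |g. g \<in> set us \<rightarrow>\<^sub>E D \<and> map (t_map (set us) F g) \<alpha>s \<in> Q0}"
      by (intro exI[of _ k] exI[of _ Q] exI[of _ "map (\<lambda>u. ([u], (1, f))) us"]) simp_all
  qed simp_all
qed

text \<open>\<open>D\<close> numbers the idempotent polymorphisms and \<open>f\<^sub>x\<close>
  evaluates at the enumeration \<open>bs\<close>; the \<open>i\<close>-th projection takes the value
  \<open>bs ! i\<close> there, whence surjectivity.\<close>

lemma ex_stable_encoding:
  assumes fs: "finite_struct B" and bs: "set bs = univ B"
    and cautious: "diagonal_cautious (univ B) bs (polymorphisms B)"
  shows "\<exists>(D :: nat set) (F :: (nat, 'b) emap set).
            finite D \<and> encoding B D F \<and> (\<forall>(k, f) \<in> F. k \<le> 1) \<and>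
            F_stable B D F \<and>
            (\<exists>f\<^sub>x. (1, f\<^sub>x) \<in> F \<and> (\<lambda>d. f\<^sub>x [d]) ` D = univ B \<and>
               (\<forall>(k, Q) \<in> set (rels B).
                  F_induced B D F k (\<Union>q \<in> Q. listset (map (\<lambda>b. {d \<in> D. f\<^sub>x [d] = b}) q))))"
proof -
  let ?n = "length bs"
  have fin: "finite (univ B)" using fs by (simp add: finite_struct_def)
  obtain dec and D :: "nat set" where D: "finite D" "bij_betw dec D (idem_polys B ?n)"
    using ex_bij_betw_nat_finite[OF finite_idem_polys[OF fin]] by blast
  let ?F = "eval_encoding B ?n D dec"
  let ?x = "\<lambda>i\<in>{..<?n}. bs ! i"
  have x: "?x \<in> {..<?n} \<rightarrow>\<^sub>E univ B"
    using bs nth_mem by auto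
  have dec_D: "dec ` D = idem_polys B ?n"
    using D(2) by (simp add: bij_betw_def)
  have f: "(1, eval_map D dec ?x) \<in> ?F"
    using x by (simp add: eval_encoding_def)
  have "(\<lambda>d. eval_map D dec ?x [d]) ` D = (\<lambda>p. p ?x) ` idem_polys B ?n"
    by (simp add: eval_map_singleton dec_D[symmetric] image_image)
  also have "\<dots> = univ B"
  proof
    show "(\<lambda>p. p ?x) ` idem_polys B ?n \<subseteq> univ B"
      using x idem_polysD(2) by blast
    show "univ B \<subseteq> (\<lambda>p. p ?x) ` idem_polys B ?n"
    proof
      fix b assume "b \<in> univ B"
      then obtain i where i: "i < ?n" "b = bs ! i"
        using bs by (metis in_set_conv_nth)
      show "b \<in> (\<lambda>p. p ?x) ` idem_polys B ?n"
        by (rule rev_image_eqI[OF projection_idem_poly[OF fs i(1)]]) (use x i in simp)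
    qed
  qed
  finally have "(\<lambda>d. eval_map D dec ?x [d]) ` D = univ B" .
  moreover have "encoding B D ?F"
    by (rule encoding_eval_encoding[OF fin]) (simp add: dec_D)
  moreover have "F_stable B D ?F"
    by (rule F_stable_eval_encoding[OF fs bs cautious D(2)])
  moreover have "\<forall>(k, f) \<in> ?F. k \<le> 1"
    by (auto simp: eval_encoding_def)
  ultimately show ?thesis
    using D(1) f F_induced_preimages[OF fs _ f, of _ _ D]
    by (intro exI[of _ D] exI[of _ ?F] conjI exI[of _ "eval_map D dec ?x"]) auto
qed


section \<open>Two-way transducers\<close>

text \<open>
  The input is read-only and the output is only appended to. As \<open>trel\<close> keeps the head within
  one cell of the input, a halting computation takes at most \<open>card Q * (length w + 2)\<close> steps: it
  cannot repeat a pair of a state and a head position.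
\<close>

type_synonym 'q transducer = "'q \<Rightarrow> nat \<Rightarrow> 'q \<times> dir \<times> nat option"

fun tstep :: "'q transducer \<Rightarrow> nat list \<Rightarrow> 'q \<times> int \<times> nat list \<Rightarrow> 'q \<times> int \<times> nat list" where
  "tstep \<delta> w (q, h, out) =
     (case \<delta> q (contents w h) of (q', d, x) \<Rightarrow>
        (q', h + offset d, out @ (case x of None \<Rightarrow> [] | Some a \<Rightarrow> [a])))"

definition trel ::
  "'q transducer \<Rightarrow> 'q \<Rightarrow> nat list \<Rightarrow> 'q \<times> int \<times> nat list \<Rightarrow> 'q \<times> int \<times> nat list \<Rightarrow> bool" where
  "trel \<delta> H w c c' \<longleftrightarrow>
     fst c \<noteq> H \<and> - 1 \<le> fst (snd c) \<and> fst (snd c) \<le> int (length w) \<and> c' = tstep \<delta> w c"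

section \<open>Length of halting runs\<close>

text \<open>Converts a derivation of reachability into a step count for a deterministic machine,
  keeping the invariant \<open>P\<close> at all earlier times.\<close>

lemma rtranclp_funpow:
  assumes "R\<^sup>*\<^sup>* c c'" "\<And>x y. R x y \<Longrightarrow> P x \<and> y = S x"
  obtains n where "c' = (S ^^ n) c" "\<And>k. k < n \<Longrightarrow> P ((S ^^ k) c)"
proof -
  from assms(1) have "\<exists>n. c' = (S ^^ n) c \<and> (\<forall>k < n. P ((S ^^ k) c))"
  proof induction
    case base
    show ?case by (intro exI[of _ 0]) simp
  next
    case (step y z)
    then obtain n where "y = (S ^^ n) c" "\<forall>k < n. P ((S ^^ k) c)" by blast
    with step.hyps(2) assms(2) show ?case
      by (intro exI[of _ "Suc n"]) (auto simp: less_Suc_eq)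
  qed
  with that show ?thesis by blast
qed

text \<open>The observation \<open>\<pi>\<close> determines its own future. If it repeated at times
  \<open>i < j\<close>, the halting observation would already occur at time
  \<open>n - j + i\<close>, which is before \<open>n\<close>.\<close>

lemma halting_time_le_card:
  fixes \<pi> :: "'c \<Rightarrow> 'p"
  assumes cong: "\<And>x y. \<pi> x = \<pi> y \<Longrightarrow> \<pi> (S x) = \<pi> (S y)"
    and before: "\<And>k. k < n \<Longrightarrow> \<pi> ((S ^^ k) c) \<in> A"
    and halt: "\<pi> ((S ^^ n) c) \<notin> A"
    and fin: "finite A"
  shows "n \<le> card A"
proof -
  have "inj_on (\<lambda>k. \<pi> ((S ^^ k) c)) {..<n}"
  proof (rule linorder_inj_onI)
    fix i j assume ij: "i < j" "i \<in> {..<n}" "j \<in> {..<n}"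
    show "\<pi> ((S ^^ i) c) \<noteq> \<pi> ((S ^^ j) c)"
    proof
      assume "\<pi> ((S ^^ i) c) = \<pi> ((S ^^ j) c)"
      then have "\<pi> ((S ^^ (m + i)) c) = \<pi> ((S ^^ (m + j)) c)" for m
        by (induction m) (auto intro: cong)
      from this[of "n - j"] ij have "\<pi> ((S ^^ (n - j + i)) c) = \<pi> ((S ^^ n) c)"
        by simp
      moreover have "n - j + i < n" using ij by auto
      ultimately show False using before halt by metis
    qed
  qed auto
  then have "card {..<n} \<le> card A"
    by (rule card_inj_on_le) (use before fin in auto)
  then show ?thesis by simp
qed

lemma contents_append: "contents (xs @ [a]) = (contents xs)(int (length xs) := a)"
  by (auto simp: contents_def nth_append fun_eq_iff)

lemma contents_less: "set w \<subseteq> {..<s} \<Longrightarrow> 0 < s \<Longrightarrow> contents w i < s"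
  by (force simp: contents_def)

section \<open>Simulation by a Turing machine\<close>

text \<open>A two-tape machine simulates the transducer step for step: one tape holds the input, the
  other collects the output. Only termination has to be supplied, as the running time is bounded by
  the number of state-position pairs.\<close>

lemma polytime_computable_transducer:
  fixes \<delta> :: "'q transducer"
  assumes fin: "finite Q" and q0: "q0 \<in> Q" "q0 \<noteq> H" and s: "0 < s"
    and closed: "\<And>q a q' d x. q \<in> Q \<Longrightarrow> q \<noteq> H \<Longrightarrow> a < s \<Longrightarrow> \<delta> q a = (q', d, x) \<Longrightarrow>
      q' \<in> insert H Q \<and> (\<forall>b. x = Some b \<longrightarrow> b < s)"
    and input: "\<And>x. x \<in> I \<Longrightarrow> set (enc x) \<subseteq> {1..<s}"
    and run: "\<And>x. x \<in> I \<Longrightarrow> \<exists>h. (trel \<delta> H (enc x))\<^sup>*\<^sup>* (q0, 0, []) (H, h, enc' (f x))"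
  shows "polytime_computable I enc enc' f"
proof -
  \<comment> \<open>The state \<open>q0\<close> is set aside to be listed first, since the initial
    state of a machine is \<open>0\<close>; \<open>H\<close> receives the number
    \<open>length ls\<close> of the halting state.\<close>
  obtain l where l: "set l = Q - {H, q0}" "distinct l"
    using finite_distinct_list[of "Q - {H, q0}"] fin by auto
  define ls where "ls = q0 # l"
  have ls: "set ls = Q - {H}" "distinct ls"
    using l q0 by (auto simp: ls_def)
  define num where "num q = (if q = H then length ls else the_inv_into {..<length ls} ((!) ls) q)" for q
  have inj: "inj_on ((!) ls) {..<length ls}"
    using ls(2) by (auto simp: inj_on_def nth_eq_iff_index_eq)
  have num_nth: "num (ls ! i) = i" if "i < length ls" for i
    using that ls(1) nth_mem[OF that] inj by (auto simp: num_def the_inv_into_f_f)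
  have num: "num q < length ls" "ls ! num q = q" if "q \<in> Q" "q \<noteq> H" for q
  proof -
    from that ls(1) obtain i where "i < length ls" "ls ! i = q"
      by (metis DiffI in_set_conv_nth singletonD)
    with num_nth[of i] show "num q < length ls" "ls ! num q = q" by auto
  qed
  have num_H: "num H = length ls" by (simp add: num_def)
  have num_q0: "num q0 = 0"
    using num_nth[of 0] by (simp add: ls_def)
  \<comment> \<open>The symbol read on tape 0 is written back, so the input stays intact. Tape 1
    moves only when a letter is emitted.\<close>
  define M where "M = \<lparr>tapes = 2, states = length ls, symbols = s,
    delta = (\<lambda>i rs. case \<delta> (ls ! i) (rs ! 0) of (q', d, x) \<Rightarrow>
      (num q', [(rs ! 0, d), case x of None \<Rightarrow> (rs ! 1, Stay) | Some a \<Rightarrow> (a, MoveRight)]))\<rparr>"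
  have "wf_tm M"
    unfolding wf_tm_def
  proof (intro conjI allI impI ballI)
    fix i rs assume i: "i < states M" and rs: "rs \<in> tuples (tapes M) {..<symbols M}"
    from i have q: "ls ! i \<in> Q" "ls ! i \<noteq> H"
      using ls(1) nth_mem[of i ls] by (auto simp: M_def)
    from rs have rs': "rs ! 0 < s" "rs ! 1 < s"
      by (auto simp: tuples_def M_def subset_iff)
    obtain q' d x where \<delta>: "\<delta> (ls ! i) (rs ! 0) = (q', d, x)" by (metis prod_cases3)
    have "num q' \<le> length ls"
      using closed[OF q rs'(1) \<delta>] num(1)[of q'] num_H by fastforce
    with \<delta> closed[OF q rs'(1) \<delta>] rs' show "case delta M i rs of (s', as) \<Rightarrow> s' \<le> states M \<and> length as = tapes M \<and> (\<forall>(w, d)\<in>set as. w < symbols M)"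
      by (auto simp: M_def split: option.splits)
  qed (use s in \<open>auto simp: M_def\<close>)
  \<comment> \<open>The head ranges over \<open>-1\<close> up to the input length, that is, over
    \<open>length w + 2\<close> positions.\<close>
  moreover define p :: "nat poly" where "p = [:2 * card Q, card Q:]"
  have "computes_within M (enc x) (enc' (f x)) (poly p (length (enc x)))" if x: "x \<in> I" for x
  proof -
    let ?w = "enc x" and ?c0 = "(q0, 0 :: int, [] :: nat list)"
    let ?S = "tstep \<delta> (enc x)"
    \<comment> \<open>The output head always rests on the blank cell just after the output written
      so far.\<close>
    define conf where "conf = (\<lambda>(q, h :: int, out). (num q, [(contents ?w, h), (contents out, int (length out))]))"
    from run[OF x] obtain h where "(trel \<delta> H ?w)\<^sup>*\<^sup>* ?c0 (H, h, enc' (f x))" by blast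
    then obtain n where n: "(H, h, enc' (f x)) = (?S ^^ n) ?c0"
      and before: "\<And>k. k < n \<Longrightarrow> fst ((?S ^^ k) ?c0) \<noteq> H \<and> - 1 \<le> fst (snd ((?S ^^ k) ?c0)) \<and>
        fst (snd ((?S ^^ k) ?c0)) \<le> int (length ?w)"
      by (rule rtranclp_funpow[where S = ?S and
            P = "\<lambda>c. fst c \<noteq> H \<and> - 1 \<le> fst (snd c) \<and> fst (snd c) \<le> int (length ?w)"])
        (auto simp: trel_def)
    have letter: "contents ?w i < s" for i
      using input[OF x] s by (intro contents_less) auto
    have stays: "fst (?S c) \<in> insert H Q" if c: "fst c \<in> Q" "fst c \<noteq> H" for c
    proof -
      obtain q h out where qh: "c = (q, h, out)" by (metis prod_cases3)
      obtain q' d y where "\<delta> q (contents ?w h) = (q', d, y)" by (metis prod_cases3)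
      with closed[OF _ _ letter this] c qh show ?thesis by simp
    qed
    have in_Q: "fst ((?S ^^ k) ?c0) \<in> insert H Q" if "k \<le> n" for k
      using that
    proof (induction k)
      case (Suc k)
      then have "fst ((?S ^^ k) ?c0) \<noteq> H" "fst ((?S ^^ k) ?c0) \<in> Q"
        using before[of k] by auto
      with stays show ?case by simp
    qed (use q0 in simp)
    have step_conf: "step M (conf c) = conf (?S c)" if c: "fst c \<in> Q" "fst c \<noteq> H" for c
    proof -
      obtain q h out where qh: "c = (q, h, out)" by (metis prod_cases3)
      obtain q' d y where \<delta>: "\<delta> q (contents ?w h) = (q', d, y)" by (metis prod_cases3)
      have "contents out (int (length out)) = 0" by (simp add: contents_def)
      then show ?thesis
        using c qh \<delta> num[of q]
        by (cases y) (simp_all add: M_def conf_def contents_append fun_upd_idem)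
    qed
    have steps: "(step M ^^ k) (conf ?c0) = conf ((?S ^^ k) ?c0)" if "k \<le> n" for k
      using that
    proof (induction k)
      case (Suc k)
      have "fst ((?S ^^ k) ?c0) \<in> Q" "fst ((?S ^^ k) ?c0) \<noteq> H"
        using Suc.prems before[of k] in_Q[of k] by auto
      from step_conf[OF this] Suc show ?case by simp
    qed simp
    have "n \<le> card (Q \<times> {- 1 .. int (length ?w)} - {H} \<times> UNIV)"
    proof (rule halting_time_le_card[where \<pi> = "\<lambda>c. (fst c, fst (snd c))" and S = ?S and c = ?c0])
      fix c c' :: "'q \<times> int \<times> nat list"
      assume "(fst c, fst (snd c)) = (fst c', fst (snd c'))"
      then show "(fst (?S c), fst (snd (?S c))) = (fst (?S c'), fst (snd (?S c')))"
        by (cases c; cases c') (auto split: prod.splits)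
    next
      fix k assume "k < n"
      then show "(fst ((?S ^^ k) ?c0), fst (snd ((?S ^^ k) ?c0))) \<in> Q \<times> {- 1 .. int (length ?w)} - {H} \<times> UNIV"
        using before[of k] in_Q[of k] by auto
    qed (use fin in \<open>auto simp: n[symmetric]\<close>)
    also have "\<dots> \<le> card (Q \<times> {- 1 .. int (length ?w)})"
      using fin by (intro card_mono) auto
    also have "\<dots> = poly p (length ?w)"
      by (simp add: p_def card_cartesian_product algebra_simps nat_add_distrib)
    finally have "n \<le> poly p (length ?w)" .
    moreover have "init_config M ?w = conf ?c0"
      by (simp add: init_config_def conf_def M_def num_q0 numeral_2_eq_2)
    ultimately show ?thesis
      unfolding computes_within_def using steps[of n]
      by (intro exI[of _ n]) (simp add: n[symmetric] conf_def num_H, simp add: M_def)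
  qed
  moreover have "symbols M = s" by (simp add: M_def)
  ultimately show ?thesis
    unfolding polytime_computable_def using input by (intro exI[of _ M] exI[of _ p]) auto
qed


section \<open>Sweeps over an encoded formula\<close>

lemma trelI:
  assumes "q \<noteq> H" "- 1 \<le> h" "h \<le> int (length w)" "\<delta> q (contents w h) = (q', d, x)"
    "h' = h + offset d" "out' = out @ (case x of None \<Rightarrow> [] | Some a \<Rightarrow> [a])"
  shows "trel \<delta> H w (q, h, out) (q', h', out')"
  using assms by (simp add: trel_def)

lemma contents_at: "contents (xs @ a # ys) (int (length xs)) = a"
  by (simp add: contents_def)

section \<open>Templates and the states of the sweeping transducer\<close>

definition bits :: "var \<Rightarrow> nat list" where
  "bits v = map (\<lambda>b. if b then 2 else 1) v"

lemma encode_var_bits: "encode_var v = bits v @ [3]"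
  by (simp add: encode_var_def bits_def)

lemma length_bits [simp]: "length (bits v) = length v"
  by (simp add: bits_def)

lemma bits_Cons: "bits (b # v) = (if b then 2 else 1) # bits v"
  by (simp add: bits_def)

lemma bits_append: "bits (u @ v) = bits u @ bits v"
  by (simp add: bits_def)

text \<open>A template is a word with holes for the current variable. \<open>Copy\<close> inserts
  its bits without the terminator \<open>3\<close>, so that a suffix can follow and form a longer
  variable name.\<close>

datatype instr = Emit nat | Copy

fun fill_instr :: "var \<Rightarrow> instr \<Rightarrow> nat list" where
  "fill_instr v (Emit a) = [a]"
| "fill_instr v Copy = bits v"

definition fill :: "instr list \<Rightarrow> var \<Rightarrow> nat list" where
  "fill is v = concat (map (fill_instr v) is)"

lemma fill_append: "fill (is @ js) v = fill is v @ fill js v"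
  by (simp add: fill_def)

lemma fill_Emit: "fill (map Emit w) v = w"
  by (induction w) (simp_all add: fill_def)

fun atom_vars :: "'v atom \<Rightarrow> 'v list" where
  "atom_vars (Rel i vs) = vs"
| "atom_vars (Eq u v) = [u, v]"

lemma set_atom_vars: "set (atom_vars a) = set_atom a"
  by (cases a) auto

text \<open>The numbers are the sweep and the index of the current relation symbol.
  \<open>Put\<close> emits a fixed word, \<open>Scan\<close> waits at the start of a token,
  \<open>Count\<close> reads a unary index, \<open>Run\<close> executes a template at a variable,
  \<open>Fwd\<close> copies the bits and \<open>Bwd\<close> returns to their start.\<close>

datatype ctrl =
    Put nat nat "nat list" | Scan nat nat | Count nat nat
  | Run nat nat "instr list" | Fwd nat nat "instr list" | Bwd nat nat "instr list"
  | Rewind nat | Halt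

text \<open>
  The machine makes \<open>passes\<close> sweeps over an encoded formula. Sweep \<open>p\<close> emits \<open>prelude p\<close>
  at its beginning, \<open>header p c\<close> for each atom and an instance of \<open>tmpl p c\<close> for each
  occurrence of a variable, where \<open>c\<close> is the index of the relation symbol of the atom, or
  \<open>m\<close> for an equality.
\<close>

locale multipass =
  fixes passes m :: nat
    and prelude :: "nat \<Rightarrow> nat list"
    and header :: "nat \<Rightarrow> nat \<Rightarrow> nat list"
    and tmpl :: "nat \<Rightarrow> nat \<Rightarrow> instr list"
  assumes passes_pos: "0 < passes"
    and prelude_letters: "set (prelude p) \<subseteq> {..<7}"
    and header_letters: "set (header p c) \<subseteq> {..<7}"
    and tmpl_letters: "set (tmpl p c) \<subseteq> insert Copy (Emit ` {..<7})"
begin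

text \<open>The blank \<open>0\<close> marks both ends of the input. \<open>Run\<close> with an
  empty template skips the current variable. The counter is capped at \<open>m\<close> to keep the
  state space finite.\<close>

fun \<delta> :: "ctrl \<Rightarrow> nat \<Rightarrow> ctrl \<times> dir \<times> nat option" where
  "\<delta> (Put p c []) a = (Scan p c, Stay, None)"
| "\<delta> (Put p c (z # zs)) a = (Put p c zs, Stay, Some z)"
| "\<delta> (Scan p c) a =
     (if a = 4 then (Count p 0, MoveRight, None)
      else if a = 5 then (Put p m (header p m), MoveRight, None)
      else if a = 0 then
        (if Suc p < passes then (Rewind (Suc p), MoveLeft, None) else (Halt, Stay, None))
      else (Run p c (tmpl p c), Stay, None))"
| "\<delta> (Count p i) a =
     (if a = 1 then (Count p (min m (Suc i)), MoveRight, None)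
      else (Put p i (header p i), MoveRight, None))"
| "\<delta> (Run p c []) a =
     (if a \<in> {1, 2} then (Run p c [], MoveRight, None) else (Scan p c, MoveRight, None))"
| "\<delta> (Run p c (Emit z # is)) a = (Run p c is, Stay, Some z)"
| "\<delta> (Run p c (Copy # is)) a = (Fwd p c is, Stay, None)"
| "\<delta> (Fwd p c is) a =
     (if a \<in> {1, 2} then (Fwd p c is, MoveRight, Some a) else (Bwd p c is, MoveLeft, None))"
| "\<delta> (Bwd p c is) a =
     (if a \<in> {1, 2} then (Bwd p c is, MoveLeft, None) else (Run p c is, MoveRight, None))"
| "\<delta> (Rewind p) a =
     (if a = 0 then (Put p 0 (prelude p), MoveRight, None) else (Rewind p, MoveLeft, None))"
| "\<delta> Halt a = (Halt, Stay, None)"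

section \<open>Runs of the sweeping transducer\<close>

abbreviation reach where
  "reach w \<equiv> (trel \<delta> Halt w)\<^sup>*\<^sup>*"

lemma reach_step:
  assumes "\<delta> q (contents w h) = (q', d, x)"
    "reach w (q', h + offset d, out @ (case x of None \<Rightarrow> [] | Some a \<Rightarrow> [a])) c"
    "q \<noteq> Halt" "- 1 \<le> h" "h \<le> int (length w)"
  shows "reach w (q, h, out) c"
  using assms by (blast intro: converse_rtranclp_into_rtranclp trelI)

lemma reach_Put:
  assumes "- 1 \<le> h" "h \<le> int (length w)"
  shows "reach w (Put p c zs, h, out) (Scan p c, h, out @ zs)"
proof (induction zs arbitrary: out)
  case Nil
  show ?case
    by (rule reach_step[of _ _ _ "Scan p c" Stay None]) (use assms in simp_all)
next
  case (Cons z zs)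
  show ?case
    by (rule reach_step[of _ _ _ "Put p c zs" Stay "Some z"])
      (use assms Cons.IH[of "out @ [z]"] in simp_all)
qed

lemma reach_Fwd:
  assumes "w = xs @ bits v @ ys"
  shows "reach w (Fwd p c is, int (length xs), out)
    (Fwd p c is, int (length (xs @ bits v)), out @ bits v)"
  using assms
proof (induction v arbitrary: xs out)
  case Nil
  then show ?case by (simp add: bits_def)
next
  case (Cons b v)
  let ?a = "if b then 2 else 1 :: nat"
  have w: "w = xs @ ?a # bits v @ ys" "w = (xs @ [?a]) @ bits v @ ys"
    using Cons.prems by (simp_all add: bits_Cons)
  have "contents w (int (length xs)) = ?a"
    unfolding w(1) by (rule contents_at)
  moreover have "length xs \<le> length w" using w(1) by simp
  ultimately show ?case
    using Cons.IH[OF w(2), of "out @ [?a]"]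
    by - (cases b; (rule reach_step[of _ _ _ _ MoveRight "Some ?a"]; simp add: bits_Cons add.commute))
qed

text \<open>The way back stops at the first cell that is not a bit; the second assumption says that
  this is the cell just left of the variable.\<close>

lemma reach_Bwd:
  assumes "w = xs @ bits v @ ys" "contents w (int (length xs) - 1) \<notin> {1, 2}"
  shows "reach w (Bwd p c is, int (length (xs @ bits v)) - 1, out) (Run p c is, int (length xs), out)"
  using assms(1)
proof (induction v arbitrary: ys rule: rev_induct)
  case Nil
  then show ?case using assms(2)
    by - (rule reach_step[of _ _ _ "Run p c is" MoveRight None], simp_all add: bits_def)
next
  case (snoc b v)
  let ?a = "if b then 2 else 1 :: nat"
  have w: "w = xs @ bits v @ ?a # ys" "w = (xs @ bits v) @ ?a # ys"
    using snoc.prems by (simp_all add: bits_append bits_def)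
  have "contents w (int (length (xs @ bits v))) = ?a"
    unfolding w(2) by (rule contents_at)
  moreover have "length (xs @ bits v) \<le> length w" using w(1) by simp
  ultimately show ?case
    using snoc.IH[OF w(1)]
    by - (rule reach_step[of _ _ _ "Bwd p c is" MoveLeft None], simp_all add: bits_append bits_def)
qed

lemma reach_Run:
  assumes w: "w = xs @ encode_var v @ ys" and left: "contents w (int (length xs) - 1) \<notin> {1, 2}"
  shows "reach w (Run p c is, int (length xs), out) (Run p c [], int (length xs), out @ fill is v)"
proof (induction "is" arbitrary: out)
  case Nil
  show ?case by (simp add: fill_def)
next
  case (Cons i "is")
  have w': "w = xs @ bits v @ 3 # ys" "w = (xs @ bits v) @ 3 # ys"
    using w by (simp_all add: encode_var_bits)
  then have len: "length xs \<le> length w" "length (xs @ bits v) \<le> length w" by simp_all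
  show ?case
  proof (cases i)
    case (Emit z)
    then show ?thesis
      using Cons.IH[of "out @ [z]"] len
      by - (rule reach_step[of _ _ _ "Run p c is" Stay "Some z"], simp_all add: fill_def)
  next
    case Copy
    have "contents w (int (length (xs @ bits v))) = 3"
      unfolding w'(2) by (rule contents_at)
    then have "reach w (Fwd p c is, int (length (xs @ bits v)), out @ bits v)
        (Run p c is, int (length xs), out @ bits v)"
      using reach_Bwd[OF w'(1) left, of p c "is" "out @ bits v"] len
      by - (rule reach_step[of _ _ _ "Bwd p c is" MoveLeft None], simp_all)
    with reach_Fwd[OF w'(1), of p c "is" out]
    have "reach w (Fwd p c is, int (length xs), out) (Run p c is, int (length xs), out @ bits v)"
      by (rule rtranclp_trans)
    then have "reach w (Fwd p c is, int (length xs), out) (Run p c [], int (length xs), out @ fill (i # is) v)"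
      using Cons.IH[of "out @ bits v"] Copy by (auto simp: fill_def intro: rtranclp_trans)
    then show ?thesis
      using Copy len by - (rule reach_step[of _ _ _ "Fwd p c is" Stay None], simp_all)
  qed
qed

lemma reach_skip:
  assumes "w = xs @ encode_var v @ ys"
  shows "reach w (Run p c [], int (length xs), out) (Scan p c, int (length (xs @ encode_var v)), out)"
  using assms
proof (induction v arbitrary: xs)
  case Nil
  then have w: "w = xs @ 3 # ys" by (simp add: encode_var_bits bits_def)
  then have "contents w (int (length xs)) = 3" using contents_at by simp
  with w show ?case
    by - (rule reach_step[of _ _ _ "Scan p c" MoveRight None],
      simp_all add: encode_var_bits bits_def add.commute)
next
  case (Cons b v)
  let ?a = "if b then 2 else 1 :: nat"
  have w: "w = xs @ ?a # encode_var v @ ys" "w = (xs @ [?a]) @ encode_var v @ ys"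
    using Cons.prems by (simp_all add: encode_var_bits bits_Cons)
  have "contents w (int (length xs)) = ?a"
    unfolding w(1) by (rule contents_at)
  moreover have "length xs \<le> length w" using w(1) by simp
  ultimately show ?case
    using Cons.IH[OF w(2)]
    by - (cases b; (rule reach_step[of _ _ _ "Run p c []" MoveRight None];
      simp add: encode_var_bits bits_Cons add.commute))
qed

lemma reach_var:
  assumes w: "w = xs @ encode_var v @ ys" and left: "contents w (int (length xs) - 1) \<notin> {1, 2}"
  shows "reach w (Scan p c, int (length xs), out)
    (Scan p c, int (length (xs @ encode_var v)), out @ fill (tmpl p c) v)"
proof (rule reach_step)
  obtain a zs where a: "encode_var v = a # zs" "a \<in> {1, 2, 3}"
    by (cases v) (auto simp: encode_var_def)
  then have "contents w (int (length xs)) = a"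
    using w contents_at by simp
  with a show "\<delta> (Scan p c) (contents w (int (length xs))) = (Run p c (tmpl p c), Stay, None)"
    by auto
  show "reach w (Run p c (tmpl p c), int (length xs) + offset Stay, out @ (case None of None \<Rightarrow> [] | Some a \<Rightarrow> [a]))
    (Scan p c, int (length (xs @ encode_var v)), out @ fill (tmpl p c) v)"
    using rtranclp_trans[OF reach_Run[OF w left] reach_skip[OF w]] by simp
qed (use w in simp_all)

lemma reach_vars:
  assumes "w = xs @ concat (map encode_var vs) @ ys" "contents w (int (length xs) - 1) \<notin> {1, 2}"
  shows "reach w (Scan p c, int (length xs), out)
    (Scan p c, int (length (xs @ concat (map encode_var vs))), out @ concat (map (fill (tmpl p c)) vs))"
  using assms
proof (induction vs arbitrary: xs out)
  case Nil
  then show ?case by simp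
next
  case (Cons v vs)
  have w: "w = xs @ encode_var v @ concat (map encode_var vs) @ ys"
    "w = (xs @ encode_var v) @ concat (map encode_var vs) @ ys"
    "w = (xs @ bits v) @ 3 # concat (map encode_var vs) @ ys"
    using Cons.prems(1) by (simp_all add: encode_var_bits[of v])
  have "contents w (int (length (xs @ bits v))) = 3"
    unfolding w(3) by (rule contents_at)
  \<comment> \<open>The cell before the next variable holds the terminator \<open>3\<close> of the
    one just read.\<close>
  then have left: "contents w (int (length (xs @ encode_var v)) - 1) \<notin> {1, 2}"
    by (simp add: encode_var_bits)
  show ?case
    using rtranclp_trans[OF reach_var[OF w(1) Cons.prems(2)] Cons.IH[OF w(2) left]] by simp
qed

text \<open>Under the bound \<open>i + k \<le> m\<close> the cap of the counter never alters a
  value.\<close>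

lemma reach_Count:
  assumes "w = xs @ replicate k 1 @ ys" "i + k \<le> m"
  shows "reach w (Count p i, int (length xs), out) (Count p (i + k), int (length xs + k), out)"
  using assms
proof (induction k arbitrary: xs i)
  case 0
  then show ?case by simp
next
  case (Suc k)
  have w: "w = xs @ 1 # replicate k 1 @ ys" "w = (xs @ [1]) @ replicate k 1 @ ys"
    using Suc.prems by simp_all
  have "contents w (int (length xs)) = 1"
    unfolding w(1) by (rule contents_at)
  moreover have "length xs \<le> length w" using w(1) by simp
  ultimately show ?case
    using Suc.IH[OF w(2), of "Suc i"] Suc.prems
    by - (rule reach_step[of _ _ _ "Count p (Suc i)" MoveRight None], simp_all add: add.commute)
qed

fun context_of :: "'v atom \<Rightarrow> nat" where
  "context_of (Rel i vs) = i"
| "context_of (Eq u v) = m"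

definition atom_output :: "nat \<Rightarrow> var atom \<Rightarrow> nat list" where
  "atom_output p a =
     header p (context_of a) @ concat (map (fill (tmpl p (context_of a))) (atom_vars a))"

lemma reach_atom:
  assumes w: "w = xs @ encode_atom a @ ys" and a: "context_of a \<le> m"
  shows "reach w (Scan p c, int (length xs), out)
    (Scan p (context_of a), int (length (xs @ encode_atom a)), out @ atom_output p a)"
proof (cases a)
  case (Rel i vs)
  define us where "us = xs @ 4 # replicate i 1"
  have w1: "w = xs @ 4 # replicate i 1 @ 3 # concat (map encode_var vs) @ ys"
    "w = (xs @ [4]) @ replicate i 1 @ 3 # concat (map encode_var vs) @ ys"
    "w = us @ 3 # concat (map encode_var vs) @ ys"
    "w = (us @ [3]) @ concat (map encode_var vs) @ ys"
    using w Rel by (simp_all add: us_def)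
  have len: "length xs \<le> length w" "length us \<le> length w" "length (us @ [3]) \<le> length w"
    using w1 by simp_all
  have "contents w (int (length xs)) = 4"
    unfolding w1(1) by (rule contents_at)
  then have 1: "reach w (Scan p c, int (length xs), out) (Count p 0, int (length (xs @ [4])), out)"
    using len by - (rule reach_step[of _ _ _ "Count p 0" MoveRight None], simp_all add: add.commute)
  have 2: "reach w (Count p 0, int (length (xs @ [4])), out) (Count p i, int (length us), out)"
    using reach_Count[OF w1(2), of 0 p out] a Rel by (simp add: us_def)
  have three: "contents w (int (length us)) = 3"
    unfolding w1(3) by (rule contents_at)
  then have 3: "reach w (Count p i, int (length us), out) (Put p i (header p i), int (length (us @ [3])), out)"
    using len by - (rule reach_step[of _ _ _ "Put p i (header p i)" MoveRight None], simp_all add: add.commute)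
  have 4: "reach w (Put p i (header p i), int (length (us @ [3])), out)
      (Scan p i, int (length (us @ [3])), out @ header p i)"
    using len by (intro reach_Put) simp_all
  have 5: "reach w (Scan p i, int (length (us @ [3])), out @ header p i)
      (Scan p i, int (length ((us @ [3]) @ concat (map encode_var vs))),
        (out @ header p i) @ concat (map (fill (tmpl p i)) vs))"
    using three by (intro reach_vars[OF w1(4)]) simp
  from rtranclp_trans[OF rtranclp_trans[OF rtranclp_trans[OF rtranclp_trans[OF 1 2] 3] 4] 5]
  show ?thesis
    using Rel by (simp add: us_def atom_output_def)
next
  case (Eq u v)
  have w1: "w = xs @ 5 # concat (map encode_var [u, v]) @ ys"
    "w = (xs @ [5]) @ concat (map encode_var [u, v]) @ ys"
    using w Eq by simp_all
  have len: "length xs \<le> length w" "length (xs @ [5]) \<le> length w"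
    using w1 by simp_all
  have five: "contents w (int (length xs)) = 5"
    unfolding w1(1) by (rule contents_at)
  then have 1: "reach w (Scan p c, int (length xs), out) (Put p m (header p m), int (length (xs @ [5])), out)"
    using len by - (rule reach_step[of _ _ _ "Put p m (header p m)" MoveRight None], simp_all add: add.commute)
  have 2: "reach w (Put p m (header p m), int (length (xs @ [5])), out)
      (Scan p m, int (length (xs @ [5])), out @ header p m)"
    using len by (intro reach_Put) simp_all
  have 3: "reach w (Scan p m, int (length (xs @ [5])), out @ header p m)
      (Scan p m, int (length ((xs @ [5]) @ concat (map encode_var [u, v]))),
        (out @ header p m) @ concat (map (fill (tmpl p m)) [u, v]))"
    using five by (intro reach_vars[OF w1(2)]) simp
  from rtranclp_trans[OF rtranclp_trans[OF 1 2] 3] show ?thesis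
    using Eq by (simp add: atom_output_def)
qed

lemma reach_atoms:
  assumes "w = xs @ encode_formula \<phi> @ ys" "\<forall>a \<in> set \<phi>. context_of a \<le> m"
  shows "\<exists>c'. reach w (Scan p c, int (length xs), out)
    (Scan p c', int (length (xs @ encode_formula \<phi>)), out @ concat (map (atom_output p) \<phi>))"
  using assms
proof (induction \<phi> arbitrary: xs c out)
  case Nil
  then show ?case by (auto simp: encode_formula_def)
next
  case (Cons a \<phi>)
  have w: "w = xs @ encode_atom a @ encode_formula \<phi> @ ys"
    "w = (xs @ encode_atom a) @ encode_formula \<phi> @ ys"
    using Cons.prems(1) by (simp_all add: encode_formula_def)
  have "context_of a \<le> m" using Cons.prems(2) by simp
  note 1 = reach_atom[OF w(1) this, of p c out]
  from Cons.IH[OF w(2), of "context_of a" "out @ atom_output p a"] Cons.prems(2) obtain c' where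
    "reach w (Scan p (context_of a), int (length (xs @ encode_atom a)), out @ atom_output p a)
      (Scan p c', int (length ((xs @ encode_atom a) @ encode_formula \<phi>)),
        (out @ atom_output p a) @ concat (map (atom_output p) \<phi>))"
    by auto
  with 1 show ?case
    by (intro exI[of _ c']) (simp add: encode_formula_def)
qed

text \<open>The position is \<open>k - 1\<close> so that the induction ends at the blank left of the
  input; this also covers the empty input.\<close>

lemma reach_Rewind:
  assumes "0 \<notin> set w" "k \<le> length w"
  shows "reach w (Rewind p, int k - 1, out) (Put p 0 (prelude p), 0, out)"
  using assms(2)
proof (induction k)
  case 0
  show ?case
    by (rule reach_step[of _ _ _ "Put p 0 (prelude p)" MoveRight None]) (simp_all add: contents_def)
next
  case (Suc k)
  then have "w ! k \<in> set w" by simp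
  with assms(1) have "w ! k \<noteq> 0" by metis
  then have "contents w (int k) \<noteq> 0"
    using Suc.prems by (simp add: contents_def)
  with Suc show ?case
    by - (rule reach_step[of _ _ _ "Rewind p" MoveLeft None], simp_all)
qed

section \<open>Output of complete sweeps\<close>

definition pass_output :: "var formula \<Rightarrow> nat \<Rightarrow> nat list" where
  "pass_output \<phi> p = prelude p @ concat (map (atom_output p) \<phi>)"

lemma encode_formula_letters: "set (encode_formula \<phi>) \<subseteq> {1..<7}"
proof -
  have "set (encode_var v) \<subseteq> {1..<7}" for v
    by (auto simp: encode_var_def)
  then have "set (encode_atom a) \<subseteq> {1..<7}" for a
    by (cases a) fastforce+
  then show ?thesis by (fastforce simp: encode_formula_def)
qed

lemma reach_pass:
  assumes "w = encode_formula \<phi>" "\<forall>a \<in> set \<phi>. context_of a \<le> m"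
  shows "\<exists>c'. reach w (Put p 0 (prelude p), 0, out) (Scan p c', int (length w), out @ pass_output \<phi> p)"
proof -
  have "reach w (Put p 0 (prelude p), 0, out) (Scan p 0, 0, out @ prelude p)"
    by (rule reach_Put) simp_all
  moreover obtain c' where "reach w (Scan p 0, 0, out @ prelude p)
      (Scan p c', int (length w), out @ pass_output \<phi> p)"
    using reach_atoms[of w "[]" \<phi> "[]" p 0 "out @ prelude p"] assms by (auto simp: pass_output_def)
  ultimately show ?thesis by (meson rtranclp_trans)
qed

lemma reach_passes:
  assumes w: "w = encode_formula \<phi>" and \<phi>: "\<forall>a \<in> set \<phi>. context_of a \<le> m" and "p < passes"
  shows "\<exists>c'. reach w (Put 0 0 (prelude 0), 0, [])
    (Scan p c', int (length w), concat (map (pass_output \<phi>) [0..<Suc p]))"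
  using assms(3)
proof (induction p)
  case 0
  show ?case using reach_pass[OF w \<phi>, of 0 "[]"] by simp
next
  case (Suc p)
  let ?out = "concat (map (pass_output \<phi>) [0..<Suc p])"
  from Suc obtain c where 1: "reach w (Put 0 0 (prelude 0), 0, []) (Scan p c, int (length w), ?out)"
    by auto
  have 2: "reach w (Scan p c, int (length w), ?out) (Put (Suc p) 0 (prelude (Suc p)), 0, ?out)"
  proof (rule reach_step[of _ _ _ "Rewind (Suc p)" MoveLeft None])
    have "0 \<notin> set w" using encode_formula_letters[of \<phi>] w by auto
    then show "reach w (Rewind (Suc p), int (length w) + offset MoveLeft,
        ?out @ (case None of None \<Rightarrow> [] | Some a \<Rightarrow> [a])) (Put (Suc p) 0 (prelude (Suc p)), 0, ?out)"
      using reach_Rewind[of w "length w" "Suc p" ?out] by simp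
  qed (use Suc.prems in \<open>simp_all add: contents_def\<close>)
  from reach_pass[OF w \<phi>, of "Suc p" ?out] obtain c' where
    3: "reach w (Put (Suc p) 0 (prelude (Suc p)), 0, ?out)
      (Scan (Suc p) c', int (length w), ?out @ pass_output \<phi> (Suc p))" by blast
  from rtranclp_trans[OF rtranclp_trans[OF 1 2] 3] show ?case
    by (intro exI[of _ c']) simp
qed

lemma reach_output:
  assumes "\<forall>a \<in> set \<phi>. context_of a \<le> m"
  shows "\<exists>h. reach (encode_formula \<phi>) (Put 0 0 (prelude 0), 0, [])
    (Halt, h, concat (map (pass_output \<phi>) [0..<passes]))"
proof -
  let ?w = "encode_formula \<phi>" and ?out = "concat (map (pass_output \<phi>) [0..<passes])"
  have p: "Suc (passes - 1) = passes" using passes_pos by simp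
  obtain c where 1: "reach ?w (Put 0 0 (prelude 0), 0, []) (Scan (passes - 1) c, int (length ?w), ?out)"
    using reach_passes[OF refl assms, of "passes - 1"] passes_pos unfolding p by auto
  have "reach ?w (Scan (passes - 1) c, int (length ?w), ?out) (Halt, int (length ?w), ?out)"
    by (rule reach_step[of _ _ _ Halt Stay None]) (simp_all add: contents_def p)
  with 1 show ?thesis by (meson rtranclp_trans)
qed

text \<open>What remains is finiteness of the control: sweeps and symbol indices are bounded, and
  the stored words are suffixes of finitely many fixed words.\<close>

lemma polytime_computable_multipass:
  assumes "\<And>\<phi>. \<phi> \<in> I \<Longrightarrow> \<forall>a \<in> set \<phi>. context_of a \<le> m"
    and "\<And>\<phi>. \<phi> \<in> I \<Longrightarrow> enc' (f \<phi>) = concat (map (pass_output \<phi>) [0..<passes])"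
  shows "polytime_computable I encode_formula enc' f"
proof -
  have "finite ((length \<circ> prelude) ` {..<passes} \<union>
      (\<lambda>(p, c). length (header p c) + length (tmpl p c)) ` ({..<passes} \<times> {..m}))"
    by simp
  then obtain L where L: "\<forall>k \<in> (length \<circ> prelude) ` {..<passes} \<union>
      (\<lambda>(p, c). length (header p c) + length (tmpl p c)) ` ({..<passes} \<times> {..m}). k \<le> L"
    by (meson finite_nat_set_iff_bounded_le)
  have L1: "length (prelude p) \<le> L" if "p < passes" for p
    using that L by auto
  have "length (header p c) + length (tmpl p c) \<le> L" if "p < passes" "c \<le> m" for p c
    using that L by fastforce
  then have L2: "length (header p c) \<le> L" "length (tmpl p c) \<le> L" if "p < passes" "c \<le> m" for p c
    using that by (meson add_leD1 add_leD2)+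
  define Z where "Z = {zs. set zs \<subseteq> {..<7 :: nat} \<and> length zs \<le> L}"
  define J where "J = {is. set is \<subseteq> insert Copy (Emit ` {..<7}) \<and> length is \<le> L}"
  define Q where "Q = {q. case q of
      Put p c zs \<Rightarrow> p < passes \<and> c \<le> m \<and> zs \<in> Z
    | Scan p c \<Rightarrow> p < passes \<and> c \<le> m
    | Count p c \<Rightarrow> p < passes \<and> c \<le> m
    | Run p c is \<Rightarrow> p < passes \<and> c \<le> m \<and> is \<in> J
    | Fwd p c is \<Rightarrow> p < passes \<and> c \<le> m \<and> is \<in> J
    | Bwd p c is \<Rightarrow> p < passes \<and> c \<le> m \<and> is \<in> J
    | Rewind p \<Rightarrow> p < passes
    | Halt \<Rightarrow> True}"
  have "Q \<subseteq> insert Halt (Rewind ` {..<passes} \<union> (\<Union>p<passes. \<Union>c\<le>m.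
    {Scan p c, Count p c} \<union> Put p c ` Z \<union> Run p c ` J \<union> Fwd p c ` J \<union> Bwd p c ` J))"
    (is "_ \<subseteq> ?Q'")
  proof
    fix q assume "q \<in> Q"
    then show "q \<in> ?Q'"
      by (cases q) (simp_all add: Q_def; blast)+
  qed
  moreover have "finite Z" "finite J"
    by (simp_all add: Z_def J_def finite_lists_length_le)
  then have "finite ?Q'"
    by simp
  ultimately have "finite Q"
    by (rule finite_subset)
  have Z: "[] \<in> Z" "z # zs \<in> Z \<Longrightarrow> z < 7 \<and> zs \<in> Z" "p < passes \<Longrightarrow> prelude p \<in> Z"
    "p < passes \<Longrightarrow> c \<le> m \<Longrightarrow> header p c \<in> Z" for z zs p c
    using prelude_letters[of p] header_letters[of p c] L1 L2 by (auto simp: Z_def)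
  have J: "[] \<in> J" "Emit z # is \<in> J \<Longrightarrow> z < 7" "i # is \<in> J \<Longrightarrow> is \<in> J"
    "p < passes \<Longrightarrow> c \<le> m \<Longrightarrow> tmpl p c \<in> J" for i z "is" p c
    using tmpl_letters[of p c] L2 by (auto simp: J_def)
  show ?thesis
  proof (rule polytime_computable_transducer[where s = 7 and H = Halt and \<delta> = \<delta>])
    show "finite Q" by fact
    show "Put 0 0 (prelude 0) \<in> Q"
      using passes_pos Z by (simp add: Q_def)
    show "\<exists>h. reach (encode_formula \<phi>) (Put 0 0 (prelude 0), 0, []) (Halt, h, enc' (f \<phi>))"
      if "\<phi> \<in> I" for \<phi>
      using reach_output[OF assms(1)[OF that]] assms(2)[OF that] by simp
    fix q a q' d x
    assume "q \<in> Q" "q \<noteq> Halt" "a < 7" "\<delta> q a = (q', d, x)"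
    then show "q' \<in> insert Halt Q \<and> (\<forall>b. x = Some b \<longrightarrow> b < 7)"
      by (cases "(q, a)" rule: \<delta>.cases) (auto simp: Q_def Z(1,3,4) J(1,4) split: if_splits dest: Z(2) J(2,3))
  qed (use encode_formula_letters in auto)
qed

end


section \<open>The reduction\<close>

lemma concat_map_concat: "concat (map e (concat (map f xs))) = concat (map (\<lambda>x. concat (map e (f x))) xs)"
  by (induction xs) simp_all

text \<open>A one-hot word of fixed length \<open>L\<close>. Used as a suffix, it can be split off
  any variable name unambiguously.\<close>

definition code :: "nat \<Rightarrow> nat \<Rightarrow> var" where
  "code L i = map (\<lambda>j. j = i) [0..<L]"

lemma length_code [simp]: "length (code L i) = L"
  by (simp add: code_def)

lemma inj_on_code: "inj_on (code L) {..<L}"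
proof (rule inj_onI)
  fix i j assume ij: "i \<in> {..<L}" "j \<in> {..<L}" "code L i = code L j"
  then have "code L i ! i = code L j ! i" by simp
  with ij(1,2) show "i = j" by (simp add: code_def)
qed

text \<open>
  In the atoms of a template, \<open>(True, i)\<close> stands for the variable at hand followed by
  \<open>code L i\<close>, and \<open>(False, i)\<close> for \<open>code L i\<close> alone.
\<close>

fun inst :: "nat \<Rightarrow> var \<Rightarrow> bool \<times> nat \<Rightarrow> var" where
  "inst L v (b, i) = (if b then v else []) @ code L i"

fun var_instrs :: "nat \<Rightarrow> bool \<times> nat \<Rightarrow> instr list" where
  "var_instrs L (b, i) = (if b then [Copy] else []) @ map Emit (encode_var (code L i))"

fun atom_instrs :: "nat \<Rightarrow> (bool \<times> nat) atom \<Rightarrow> instr list" where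
  "atom_instrs L (Rel i vs) = map Emit ([4] @ replicate i 1 @ [3]) @ concat (map (var_instrs L) vs)"
| "atom_instrs L (Eq u v) = [Emit 5] @ var_instrs L u @ var_instrs L v"

lemma encode_var_concat: "encode_var (u @ v) = bits u @ encode_var v"
  by (simp add: encode_var_bits bits_append)

lemma fill_var_instrs: "fill (var_instrs L t) = (\<lambda>v. encode_var (inst L v t))"
proof
  fix v
  have "fill [Copy] v = bits v" "fill [] v = bits []" by (simp_all add: fill_def bits_def)
  then show "fill (var_instrs L t) v = encode_var (inst L v t)"
    by (cases t) (simp add: fill_append fill_Emit encode_var_concat)
qed

lemma fill_concat: "fill (concat (map f xs)) = (\<lambda>v. concat (map (\<lambda>x. fill (f x) v) xs))"
proof
  show "fill (concat (map f xs)) v = concat (map (\<lambda>x. fill (f x) v) xs)" for v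
  proof (induction xs)
    case Nil
    show ?case by (simp add: fill_def)
  qed (simp add: fill_append)
qed

text \<open>Running the template of an atom at \<open>v\<close> writes exactly the encoding of its
  instance at \<open>v\<close>; this links the machine to the formulas.\<close>

lemma fill_atom_instrs: "fill (atom_instrs L a) = (\<lambda>v. encode_atom (map_atom (inst L v) a))"
proof (rule ext, cases a)
  fix v
  case (Rel i vs)
  have "fill (map Emit ([4] @ replicate i 1 @ [3]) @ concat (map (var_instrs L) vs)) v =
      ([4] @ replicate i 1 @ [3]) @ concat (map (\<lambda>t. encode_var (inst L v t)) vs)"
    by (simp only: fill_append fill_Emit fill_concat fill_var_instrs)
  with Rel show "fill (atom_instrs L a) v = encode_atom (map_atom (inst L v) a)"
    by (simp add: comp_def)
next
  fix v
  case (Eq s t)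
  have "fill [Emit 5] v = [5]" by (simp add: fill_def)
  with Eq show "fill (atom_instrs L a) v = encode_atom (map_atom (inst L v) a)"
    by (simp add: fill_append fill_var_instrs del: append_Cons append_Nil)
qed

lemma encode_var_letters: "set (encode_var v) \<subseteq> {..<7}"
  by (auto simp: encode_var_def)

lemma var_instrs_letters: "set (var_instrs L t) \<subseteq> insert Copy (Emit ` {..<7})"
  using encode_var_letters by (cases t) (auto simp: image_iff subset_iff)

lemma atom_instrs_letters: "set (atom_instrs L a) \<subseteq> insert Copy (Emit ` {..<7})"
proof (cases a)
  case (Rel i vs)
  moreover have "set (map Emit ([4] @ replicate i 1 @ [3])) \<subseteq> Emit ` {..<7}"
    by auto
  ultimately show ?thesis
    using var_instrs_letters[of L] by (simp add: UN_subset_iff subset_insertI2)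
next
  case (Eq u v)
  then show ?thesis
    using var_instrs_letters[of L u] var_instrs_letters[of L v] by simp
qed

section \<open>The reduction map\<close>

locale reduction =
  fixes B :: "'b struct" and bs :: "'b list"
  assumes fs: "finite_struct B"
    and dist: "distinct bs" and bs: "set bs = univ B"
    and cautious: "diagonal_cautious (univ B) bs (polymorphisms B)"
begin

abbreviation "n \<equiv> length bs"

abbreviation "nr \<equiv> length (rels B)"

abbreviation "Bn \<equiv> {..<n} \<rightarrow>\<^sub>E univ B"

definition Xs :: "(nat \<Rightarrow> 'b) list" where
  "Xs = (SOME xs. set xs = Bn \<and> distinct xs)"

lemma Xs: "set Xs = Bn" "distinct Xs"
proof -
  have "finite (univ B)" using fs by (simp add: finite_struct_def)
  then have "finite Bn" by (simp add: finite_extensional_funcset)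
  then have "\<exists>xs. set xs = Bn \<and> distinct xs" by (rule finite_distinct_list)
  then have "set Xs = Bn \<and> distinct Xs"
    unfolding Xs_def by (rule someI_ex)
  then show "set Xs = Bn" "distinct Xs" by blast+
qed

abbreviation "N \<equiv> length Xs"

abbreviation "L \<equiv> N + n"

definition idx :: "(nat \<Rightarrow> 'b) \<Rightarrow> nat" where
  "idx x = the_inv_into {..<N} ((!) Xs) x"

lemma idx_nth: "j < N \<Longrightarrow> idx (Xs ! j) = j"
  unfolding idx_def using Xs(2) by (intro the_inv_into_f_f) (auto simp: inj_on_def nth_eq_iff_index_eq)

lemma idx: "x \<in> Bn \<Longrightarrow> idx x < N" "x \<in> Bn \<Longrightarrow> Xs ! idx x = x"
proof -
  assume "x \<in> Bn"
  then obtain j where "j < N" "Xs ! j = x"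
    unfolding Xs(1)[symmetric] in_set_conv_nth by blast
  with idx_nth show "idx x < N" "Xs ! idx x = x" by auto
qed

definition enum :: "nat \<Rightarrow> 'b" where
  "enum = (\<lambda>i\<in>{..<n}. bs ! i)"

lemma enum: "enum \<in> Bn"
  unfolding enum_def restrict_PiE_iff using bs nth_mem by blast

lemma const_tuple: "b \<in> univ B \<Longrightarrow> (\<lambda>j\<in>{..<n}. b) \<in> Bn"
  unfolding restrict_PiE_iff by blast

lemma nth_univ: "i < n \<Longrightarrow> bs ! i \<in> univ B"
  using bs nth_mem by blast

text \<open>The equalities tie the value at each constant tuple to a variable with index
  \<open>N + i\<close> that does not depend on the variable at hand. Sharing these variables forces
  all blocks to have the same diagonal.\<close>

definition block_atoms :: "(bool \<times> nat) atom set" where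
  "block_atoms = map_atom (\<lambda>x. (True, idx x)) ` poly_atoms B n \<union>
     (\<lambda>i. Eq (True, idx (\<lambda>j\<in>{..<n}. bs ! i)) (False, N + i)) ` {..<n}"

definition block :: "(bool \<times> nat) formula" where
  "block = (SOME as. set as = block_atoms)"

lemma set_block: "set block = block_atoms"
proof -
  have "finite block_atoms"
    unfolding block_atoms_def using finite_poly_atoms[OF fs] by simp
  then have "\<exists>as. set as = block_atoms" by (rule finite_list)
  then show ?thesis unfolding block_def by (rule someI_ex)
qed

definition constants :: "var list" where
  "constants = map (\<lambda>i. code L (N + i)) [0..<n]"

definition block_vars :: "var \<Rightarrow> var list" where
  "block_vars v = map (\<lambda>i. v @ code L i) [0..<N]"

text \<open>A constant symbol cannot be expressed over \<open>B\<close>. It becomes an equality with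
  the shared diagonal variable of that constant, which is correct up to the automorphism given by
  the diagonal.\<close>

fun translate :: "var atom \<Rightarrow> var atom" where
  "translate (Rel i vs) =
     (if i < nr then Rel i (map (\<lambda>v. v @ code L (idx enum)) vs)
      else Eq (hd vs @ code L (idx enum)) (code L (N + (i - nr))))"
| "translate (Eq u v) = Eq (u @ code L (idx enum)) (v @ code L (idx enum))"

text \<open>Repetitions are kept: a sweep treats each occurrence separately, and both the variable
  list and the formula of an SCSP instance tolerate duplicates.\<close>

definition occs :: "var formula \<Rightarrow> var list" where
  "occs \<phi> = concat (map atom_vars \<phi>)"

lemma set_occs: "set (occs \<phi>) = vars \<phi>"
  by (simp add: occs_def vars_def set_atom_vars)

definition reduce :: "var formula \<Rightarrow> var list \<times> var formula" where
  "reduce \<phi> =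
     (constants @ concat (map block_vars (occs \<phi>)),
      concat (map (\<lambda>v. map (map_atom (inst L v)) block) (occs \<phi>)) @ map translate \<phi>)"

text \<open>Sweep 0 writes the variable list, sweep 1 the separator and the blocks, and sweep 2 the
  translated atoms.\<close>

definition prelude :: "nat \<Rightarrow> nat list" where
  "prelude p = (if p = 0 then concat (map encode_var constants) else if p = 1 then [6] else [])"

definition header :: "nat \<Rightarrow> nat \<Rightarrow> nat list" where
  "header p c = (if p \<le> 1 then [] else if c < nr then [4] @ replicate c 1 @ [3] else [5])"

text \<open>In sweep 2 a constant symbol has a single argument, so its template also writes the
  second side of the resulting equality. The index \<open>nr + n\<close> denotes a genuine equality,
  whose two sides come from its two occurrences of variables.\<close>

definition tmpl :: "nat \<Rightarrow> nat \<Rightarrow> instr list" where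
  "tmpl p c =
     (if p = 0 then concat (map (\<lambda>i. var_instrs L (True, i)) [0..<N])
      else if p = 1 then concat (map (atom_instrs L) block)
      else var_instrs L (True, idx enum) @
        (if nr \<le> c \<and> c < nr + n then var_instrs L (False, N + (c - nr)) else []))"

sublocale multipass 3 "nr + n" prelude header tmpl
proof
  show "set (prelude p) \<subseteq> {..<7}" for p
    using encode_var_letters by (auto simp: prelude_def UN_subset_iff)
  show "set (header p c) \<subseteq> {..<7}" for p c
    by (auto simp: header_def)
  show "set (tmpl p c) \<subseteq> insert Copy (Emit ` {..<7})" for p c
    by (auto simp: tmpl_def simp del: var_instrs.simps
        dest!: subsetD[OF var_instrs_letters] subsetD[OF atom_instrs_letters])
qed simp

abbreviation "B' \<equiv> expand_constants B bs"

lemma rels_expand: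
  "length (rels B') = nr + n" "i < nr \<Longrightarrow> rels B' ! i = rels B ! i"
  "nr \<le> i \<Longrightarrow> i < nr + n \<Longrightarrow> rels B' ! i = (1, {[bs ! (i - nr)]})"
  by (simp_all add: expand_constants_def nth_append)

lemma wf_context: "wf_atom B' a \<Longrightarrow> context_of a \<le> nr + n"
  by (cases a) (simp_all add: rels_expand)

lemma atom_output_translate:
  assumes "wf_atom B' a"
  shows "atom_output 2 a = encode_atom (translate a)"
proof (cases a)
  case (Rel i vs)
  show ?thesis
  proof (cases "i < nr")
    case True
    then show ?thesis
      using Rel by (simp add: atom_output_def header_def tmpl_def fill_var_instrs comp_def del: var_instrs.simps)
  next
    case False
    with assms Rel have i: "nr \<le> i" "i < nr + n" by (simp_all add: rels_expand)
    with assms Rel have "length vs = 1" by (simp add: rels_expand)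
    then obtain v where "vs = [v]" by (auto simp: length_Suc_conv)
    with Rel i show ?thesis
      by (simp add: atom_output_def header_def tmpl_def fill_append fill_var_instrs del: var_instrs.simps)
  qed
next
  case (Eq u v)
  then show ?thesis
    by (simp add: atom_output_def header_def tmpl_def fill_var_instrs del: var_instrs.simps)
qed

lemma encode_reduce:
  assumes "wf_formula B' \<phi>"
  shows "encode_instance (reduce \<phi>) = concat (map (pass_output \<phi>) [0..<3])"
proof -
  have occs: "concat (map (\<lambda>a. concat (map f (atom_vars a))) \<phi>) = concat (map f (occs \<phi>))"
    for f :: "var \<Rightarrow> nat list"
    by (simp add: occs_def concat_map_concat)
  have "atom_output 0 = (\<lambda>a. concat (map (\<lambda>v. concat (map encode_var (block_vars v))) (atom_vars a)))"
    by (rule ext) (simp add: atom_output_def header_def tmpl_def fill_concat fill_var_instrs block_vars_def comp_def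
        del: var_instrs.simps)
  then have 0: "pass_output \<phi> 0 = concat (map encode_var (constants @ concat (map block_vars (occs \<phi>))))"
    by (simp add: pass_output_def prelude_def occs concat_map_concat)
  have "atom_output 1 =
      (\<lambda>a. concat (map (\<lambda>v. encode_formula (map (map_atom (inst L v)) block)) (atom_vars a)))"
    by (rule ext) (simp add: atom_output_def header_def tmpl_def fill_concat fill_atom_instrs encode_formula_def comp_def)
  then have 1: "pass_output \<phi> 1 =
      [6] @ encode_formula (concat (map (\<lambda>v. map (map_atom (inst L v)) block) (occs \<phi>)))"
    by (simp add: pass_output_def prelude_def occs concat_map_concat encode_formula_def)
  have outputs: "map (atom_output 2) \<phi> = map encode_atom (map translate \<phi>)"
    using assms atom_output_translate by (simp add: wf_formula_def)
  have 2: "pass_output \<phi> 2 = encode_formula (map translate \<phi>)"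
    unfolding pass_output_def prelude_def encode_formula_def outputs by simp
  have "[0..<3] = [0, 1, 2]" by (simp add: upt_rec)
  then show ?thesis
    unfolding reduce_def by (simp add: 0 1[simplified] 2 encode_formula_def)
qed

lemma reduce_vars: "set (fst (reduce \<phi>)) =
  (\<lambda>i. code L (N + i)) ` {..<n} \<union> (\<Union>v\<in>vars \<phi>. (\<lambda>i. v @ code L i) ` {..<N})"
  by (simp add: reduce_def constants_def block_vars_def set_occs atLeast0LessThan)

lemma reduce_atoms: "set (snd (reduce \<phi>)) =
  (\<Union>v\<in>vars \<phi>. map_atom (inst L v) ` block_atoms) \<union> translate ` set \<phi>"
  by (simp add: reduce_def set_occs set_block)

lemma block_atom_cases:
  assumes "a \<in> block_atoms"
  obtains (poly) a' where "a' \<in> poly_atoms B n" "a = map_atom (\<lambda>x. (True, idx x)) a'"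
  | (const) i where "i < n" "a = Eq (True, idx (\<lambda>j\<in>{..<n}. bs ! i)) (False, N + i)"
  using assms unfolding block_atoms_def by blast

lemma reduce_wf:
  assumes wf: "wf_formula B' \<phi>"
  shows "wf_formula B (snd (reduce \<phi>))" "vars (snd (reduce \<phi>)) \<subseteq> set (fst (reduce \<phi>))"
proof -
  have var: "v @ code L i \<in> set (fst (reduce \<phi>))" if "v \<in> vars \<phi>" "i < N" for v i
    using that by (auto simp: reduce_vars)
  have const: "code L (N + i) \<in> set (fst (reduce \<phi>))" if "i < n" for i
    using that by (auto simp: reduce_vars)
  have block: "wf_atom B (map_atom (inst L v) a) \<and>
      set_atom (map_atom (inst L v) a) \<subseteq> set (fst (reduce \<phi>))"
    if v: "v \<in> vars \<phi>" and a: "a \<in> block_atoms" for v a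
    using a
  proof (cases rule: block_atom_cases)
    case (poly a')
    note wf' = poly_atoms_wf[OF fs poly(1)]
    have "inst L v (True, idx x) \<in> set (fst (reduce \<phi>))" if "x \<in> set_atom a'" for x
      using var[OF v idx(1)] subsetD[OF wf'(2) that] by simp
    with wf'(1) poly(2) show ?thesis
      by (auto simp: wf_atom_map atom.set_map)
  next
    case (const i)
    then show ?thesis
      using var[OF v idx(1)[OF const_tuple[OF nth_univ]]] \<open>i < n \<Longrightarrow> code L (N + i) \<in> _\<close> by simp
  qed
  have translate: "wf_atom B (translate a) \<and> set_atom (translate a) \<subseteq> set (fst (reduce \<phi>))"
    if a: "a \<in> set \<phi>" for a
  proof -
    have wfa: "wf_atom B' a" using wf a by (simp add: wf_formula_def)
    have vars: "set_atom a \<subseteq> vars \<phi>" using a by (auto simp: vars_def)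
    show ?thesis
    proof (cases a)
      case (Rel i vs)
      show ?thesis
      proof (cases "i < nr")
        case True
        with Rel wfa vars var[OF _ idx(1)[OF enum]] show ?thesis
          by (auto simp: rels_expand)
      next
        case False
        with wfa Rel have i: "nr \<le> i" "i < nr + n" by (simp_all add: rels_expand)
        with wfa Rel have "length vs = 1" by (simp add: rels_expand)
        then obtain v where "vs = [v]" by (auto simp: length_Suc_conv)
        with False Rel i vars var[OF _ idx(1)[OF enum]] const[of "i - nr"] show ?thesis by simp
      qed
    next
      case (Eq u v)
      with vars var[OF _ idx(1)[OF enum]] show ?thesis by simp
    qed
  qed
  show "wf_formula B (snd (reduce \<phi>))"
    using block translate unfolding wf_formula_def reduce_atoms by blast
  show "vars (snd (reduce \<phi>)) \<subseteq> set (fst (reduce \<phi>))"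
    using block translate unfolding vars_def reduce_atoms by blast
qed

section \<open>Correctness of the reduction\<close>

text \<open>Each variable \<open>v\<close> receives the projection to a coordinate where the
  enumeration has the value \<open>g v\<close>; this is a polymorphism with identity diagonal. The
  constants alone already make \<open>h\<close> onto.\<close>

lemma reduce_complete:
  assumes wf: "wf_formula B' \<phi>" and g: "g \<in> vars \<phi> \<rightarrow> univ B" and sat: "satisfies B' g \<phi>"
  shows "\<exists>h. h ` set (fst (reduce \<phi>)) = univ B \<and> satisfies B h (snd (reduce \<phi>))"
proof -
  have "\<exists>k. k < n \<and> bs ! k = g v" if "v \<in> vars \<phi>" for v
    using funcset_mem[OF g that] bs by (metis in_set_conv_nth)
  then obtain pos where pos: "\<And>v. v \<in> vars \<phi> \<Longrightarrow> pos v < n" "\<And>v. v \<in> vars \<phi> \<Longrightarrow> bs ! pos v = g v"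
    by metis
  \<comment> \<open>The last \<open>L\<close> letters of a word are decoded to an index and the rest
    is the original variable. For indices from \<open>N\<close> on, the rest is ignored.\<close>
  define h where "h w =
    (let v = take (length w - L) w; i = the_inv_into {..<L} (code L) (drop (length w - L) w)
     in if i < N then (Xs ! i) (pos v) else bs ! (i - N))" for w
  have h: "h (v @ code L i) = (if i < N then (Xs ! i) (pos v) else bs ! (i - N))" if "i < L" for v i
    using that by (simp add: h_def the_inv_into_f_f[OF inj_on_code])
  have h_block: "h (v @ code L (idx x)) = x (pos v)" if "x \<in> Bn" for v x
    using h[of "idx x" v] idx[OF that] by simp
  have h_const: "h (code L (N + i)) = bs ! i" if "i < n" for i
    using h[of "N + i" "[]"] that by simp
  have h_enum: "h (v @ code L (idx enum)) = g v" if "v \<in> vars \<phi>" for v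
    using h_block[OF enum, of v] pos[OF that] by (simp add: enum_def)
  have block: "satisfies_atom B h (map_atom (inst L v) a)" if v: "v \<in> vars \<phi>" and a: "a \<in> block_atoms" for v a
    using a
  proof (cases rule: block_atom_cases)
    case (poly a')
    let ?p = "\<lambda>x\<in>Bn. x (pos v)"
    have "satisfies_atom B ?p a'"
      using idem_polysD(4)[OF projection_idem_poly[OF fs pos(1)[OF v]] poly(1)] .
    moreover have "satisfies_atom B ?p a' \<longleftrightarrow> satisfies_atom B (h \<circ> inst L v \<circ> (\<lambda>x. (True, idx x))) a'"
    proof (rule satisfies_atom_cong)
      fix x assume "x \<in> set_atom a'"
      then have "x \<in> Bn" using poly_atoms_wf(2)[OF fs poly(1)] by blast
      then show "?p x = (h \<circ> inst L v \<circ> (\<lambda>x. (True, idx x))) x"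
        using h_block by simp
    qed
    ultimately show ?thesis
      unfolding poly(2) satisfies_atom_map by simp
  next
    case (const i)
    then show ?thesis
      using h_const[of i] h_block[OF const_tuple[OF nth_univ], of i v] pos(1)[OF v] by simp
  qed
  have translate: "satisfies_atom B h (translate a)" if a: "a \<in> set \<phi>" for a
  proof -
    have wfa: "wf_atom B' a" and sata: "satisfies_atom B' g a"
      using wf sat a by (simp_all add: wf_formula_def satisfies_def)
    have vars: "set_atom a \<subseteq> vars \<phi>" using a by (auto simp: vars_def)
    show ?thesis
    proof (cases a)
      case (Rel i vs)
      show ?thesis
      proof (cases "i < nr")
        case True
        have "map g vs \<in> snd (rels B ! i)"
          using True Rel sata by (simp add: rels_expand)
        also have "map g vs = map (h \<circ> (\<lambda>v. v @ code L (idx enum))) vs"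
          using Rel vars h_enum by auto
        finally show ?thesis using True Rel by simp
      next
        case False
        with wfa Rel have i: "nr \<le> i" "i < nr + n" by (simp_all add: rels_expand)
        with sata Rel have "map g vs = [bs ! (i - nr)]" by (simp add: rels_expand)
        then obtain v where "vs = [v]" "g v = bs ! (i - nr)" by auto
        with False Rel i vars h_enum[of v] h_const[of "i - nr"] show ?thesis by simp
      qed
    next
      case (Eq u v)
      with sata vars h_enum[of u] h_enum[of v] show ?thesis by simp
    qed
  qed
  have "h ` set (fst (reduce \<phi>)) = univ B"
  proof
    have "h (v @ code L i) \<in> univ B" if "v \<in> vars \<phi>" "i < N" for v i
      using h[of i v] PiE_mem[of "Xs ! i" "{..<n}" "\<lambda>_. univ B" "pos v"] that pos(1) Xs(1) nth_mem[of i Xs]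
      by simp
    then show "h ` set (fst (reduce \<phi>)) \<subseteq> univ B"
      unfolding reduce_vars using h_const nth_univ by auto
    show "univ B \<subseteq> h ` set (fst (reduce \<phi>))"
    proof
      fix b assume "b \<in> univ B"
      then obtain i where "i < n" "b = bs ! i"
        using bs by (metis in_set_conv_nth)
      with h_const show "b \<in> h ` set (fst (reduce \<phi>))"
        unfolding reduce_vars by (intro image_eqI[of _ _ "code L (N + i)"]) auto
    qed
  qed
  moreover have "satisfies B h (snd (reduce \<phi>))"
    using block translate unfolding satisfies_def reduce_atoms by blast
  ultimately show ?thesis by blast
qed

text \<open>A surjective solution is a family of polymorphisms with common diagonal
  \<open>c\<close>, which is thus an automorphism. Undoing \<open>c\<close> on the values at
  \<open>enum\<close> solves the original formula, constants included.\<close>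

lemma reduce_sound:
  assumes wf: "wf_formula B' \<phi>" and onto: "h ` set (fst (reduce \<phi>)) = univ B"
    and sat: "satisfies B h (snd (reduce \<phi>))"
  shows "\<exists>g \<in> vars \<phi> \<rightarrow> univ B. satisfies B' g \<phi>"
proof (cases "vars \<phi> = {}")
  case True
  \<comment> \<open>Without variables there is no family to which the diagonal argument applies; as
    arities are positive, the formula is then empty.\<close>
  have "set_atom a \<noteq> {}" if "a \<in> set \<phi>" for a
  proof (cases a)
    case (Rel i vs)
    with wf that have i: "i < nr + n" "length vs = fst (rels B' ! i)"
      by (auto simp: wf_formula_def rels_expand)
    have "1 \<le> fst (rels B' ! i)"
    proof (cases "i < nr")
      case True
      then show ?thesis
        using finite_struct_rel(1)[OF fs, of "fst (rels B ! i)" "snd (rels B ! i)"] by (simp add: rels_expand)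
    next
      case False
      with i show ?thesis by (simp add: rels_expand)
    qed
    with Rel i show ?thesis by auto
  qed simp
  with True have "\<phi> = []"
    by (cases \<phi>) (auto simp: vars_def)
  then show ?thesis by (auto simp: vars_def satisfies_def)
next
  case False
  define p where "p v x = h (v @ code L (idx x))" for v x
  \<comment> \<open>The common diagonal is read off the shared variables.\<close>
  define c where "c b = h (code L (N + the_inv_into {..<n} ((!) bs) b))" for b
  have c_nth: "c (bs ! i) = h (code L (N + i))" if "i < n" for i
  proof -
    have "the_inv_into {..<n} ((!) bs) (bs ! i) = i"
      using that dist by (intro the_inv_into_f_f) (auto simp: inj_on_def nth_eq_iff_index_eq)
    then show ?thesis by (simp add: c_def)
  qed
  have block: "satisfies_atom B h (map_atom (inst L v) a)" if "v \<in> vars \<phi>" "a \<in> block_atoms" for v a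
    using sat that unfolding satisfies_def reduce_atoms by blast
  have p_univ: "p v x \<in> univ B" if "v \<in> vars \<phi>" "x \<in> Bn" for v x
  proof -
    have "v @ code L (idx x) \<in> set (fst (reduce \<phi>))"
      unfolding reduce_vars using that(1) idx(1)[OF that(2)] by blast
    then show ?thesis
      unfolding p_def onto[symmetric] by (rule imageI)
  qed
  have poly: "({..<n}, p v) \<in> polymorphisms B" if v: "v \<in> vars \<phi>" for v
  proof -
    have "p v \<in> Bn \<rightarrow> univ B"
      using p_univ[OF v] by (rule funcsetI)
    moreover have "satisfies_atom B (p v) a" if a: "a \<in> poly_atoms B n" for a
    proof -
      have "map_atom (\<lambda>x. (True, idx x)) a \<in> block_atoms"
        using a unfolding block_atoms_def by blast
      from block[OF v this] have "satisfies_atom B (h \<circ> inst L v \<circ> (\<lambda>x. (True, idx x))) a"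
        unfolding satisfies_atom_map .
      then show ?thesis by (simp add: comp_def p_def[abs_def])
    qed
    ultimately show ?thesis by (simp add: polymorphism_iff_poly_atoms)
  qed
  have diag: "p v (\<lambda>j\<in>{..<n}. b) = c b" if v: "v \<in> vars \<phi>" and b: "b \<in> univ B" for v b
  proof -
    obtain i where i: "i < n" "b = bs ! i"
      using b bs by (metis in_set_conv_nth)
    then have "Eq (True, idx (\<lambda>j\<in>{..<n}. b)) (False, N + i) \<in> block_atoms"
      unfolding block_atoms_def by blast
    from block[OF v this] i c_nth[of i] show ?thesis by (simp add: p_def)
  qed
  have cover: "univ B \<subseteq> (\<Union>v\<in>vars \<phi>. p v ` Bn)"
  proof
    fix b assume "b \<in> univ B"
    then obtain u where u: "u \<in> set (fst (reduce \<phi>))" "b = h u"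
      using onto by blast
    from u(1) consider i where "i < n" "u = code L (N + i)"
      | v i where "v \<in> vars \<phi>" "i < N" "u = v @ code L i"
      unfolding reduce_vars by blast
    then show "b \<in> (\<Union>v\<in>vars \<phi>. p v ` Bn)"
    proof cases
      case 1
      obtain v where v: "v \<in> vars \<phi>" using False by blast
      \<comment> \<open>A value of a shared variable also occurs inside a block, at a constant
        tuple, so the blocks alone cover the universe.\<close>
      have "b = p v (\<lambda>j\<in>{..<n}. bs ! i)"
        using diag[OF v nth_univ] c_nth 1 u(2) by simp
      with v const_tuple[OF nth_univ[OF 1(1)]] show ?thesis by blast
    next
      case 2
      have "Xs ! i \<in> Bn" using 2 Xs(1) nth_mem by blast
      moreover have "b = p v (Xs ! i)" using 2 u(2) by (simp add: p_def idx_nth)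
      ultimately show ?thesis using 2(1) by blast
    qed
  qed
  from fs bs cautious poly diag cover False have aut: "automorphism B c"
    by (rule common_diagonal_automorphism)
  have inj: "inj_on c (univ B)"
    using aut by (simp add: automorphism_def bij_betw_def)
  have "\<exists>b \<in> univ B. p v enum = c b" if v: "v \<in> vars \<phi>" for v
  proof -
    obtain d where "d \<in> idem_polys B n" "\<And>x. x \<in> Bn \<Longrightarrow> p v x = c (d x)"
      using automorphism_inverse_idem_poly[OF fs aut poly[OF v] diag[OF v]] by metis
    with idem_polysD(2)[OF _ enum] enum show ?thesis by metis
  qed
  then obtain g where g: "\<And>v. v \<in> vars \<phi> \<Longrightarrow> g v \<in> univ B"
    "\<And>v. v \<in> vars \<phi> \<Longrightarrow> h (v @ code L (idx enum)) = c (g v)"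
    unfolding p_def by metis
  have "satisfies_atom B' g a" if a: "a \<in> set \<phi>" for a
  proof -
    have wfa: "wf_atom B' a" using wf a by (simp add: wf_formula_def)
    have sata: "satisfies_atom B h (translate a)"
      using sat a unfolding satisfies_def reduce_atoms by blast
    have vars: "set_atom a \<subseteq> vars \<phi>" using a by (auto simp: vars_def)
    then have g': "g v \<in> univ B" if "v \<in> set_atom a" for v
      using g(1) that by blast
    show ?thesis
    proof (cases a)
      case (Rel i vs)
      show ?thesis
      proof (cases "i < nr")
        case True
        have "map (h \<circ> (\<lambda>v. v @ code L (idx enum))) vs = map (c \<circ> g) vs"
          using Rel vars g(2) by auto
        with sata True Rel have "satisfies_atom B (c \<circ> g) a" by simp
        moreover have "wf_atom B a" using wfa True Rel by (simp add: rels_expand)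
        ultimately have "satisfies_atom B g a"
          using automorphism_satisfies_atom[OF aut, of a g] g' by blast
        with True Rel show ?thesis by (simp add: rels_expand)
      next
        case False
        with wfa Rel have i: "nr \<le> i" "i < nr + n" by (simp_all add: rels_expand)
        with wfa Rel have "length vs = 1" by (simp add: rels_expand)
        then obtain v where v: "vs = [v]" by (auto simp: length_Suc_conv)
        with Rel vars have "v \<in> vars \<phi>" by simp
        with sata False Rel v g(2) c_nth[of "i - nr"] i have "c (g v) = c (bs ! (i - nr))" by simp
        \<comment> \<open>Injectivity of \<open>c\<close> cancels the automorphism, so
          \<open>v\<close> receives the exact constant.\<close>
        with inj g(1)[OF \<open>v \<in> vars \<phi>\<close>] nth_univ[of "i - nr"] i have "g v = bs ! (i - nr)"
          by (auto dest: inj_onD)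
        with Rel v i show ?thesis by (simp add: rels_expand)
      qed
    next
      case (Eq u v)
      with vars have "u \<in> vars \<phi>" "v \<in> vars \<phi>" by simp_all
      with sata Eq g inj have "g u = g v" by (auto dest: inj_onD)
      with Eq show ?thesis by simp
    qed
  qed
  with g(1) show ?thesis by (auto simp: satisfies_def)
qed

lemma polytime_reducible_CSP_SCSP: "polytime_reducible (CSP B') (SCSP B)"
proof -
  have "polytime_computable {\<phi>. wf_formula B' \<phi>} encode_formula encode_instance reduce"
  proof (rule polytime_computable_multipass)
    fix \<phi> :: "var formula" assume \<phi>: "\<phi> \<in> {\<phi>. wf_formula B' \<phi>}"
    then show "\<forall>a \<in> set \<phi>. context_of a \<le> nr + n"
      using wf_context by (auto simp: wf_formula_def)
    from \<phi> show "encode_instance (reduce \<phi>) = concat (map (pass_output \<phi>) [0..<3])"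
      using encode_reduce by simp
  qed
  moreover have "\<phi> \<in> yes (CSP B') \<longleftrightarrow> reduce \<phi> \<in> yes (SCSP B)" if wf: "wf_formula B' \<phi>" for \<phi>
  proof -
    have univ: "univ B' = univ B" by (simp add: expand_constants_def)
    have "reduce \<phi> \<in> yes (SCSP B) \<longleftrightarrow>
        (\<exists>h. h ` set (fst (reduce \<phi>)) = univ B \<and> satisfies B h (snd (reduce \<phi>)))"
      using reduce_wf[OF wf] by (simp add: SCSP_def case_prod_unfold)
    also have "\<dots> \<longleftrightarrow> (\<exists>g \<in> vars \<phi> \<rightarrow> univ B. satisfies B' g \<phi>)"
      using reduce_complete[OF wf] reduce_sound[OF wf] by blast
    also have "\<dots> \<longleftrightarrow> \<phi> \<in> yes (CSP B')"
      using wf by (simp add: CSP_def univ)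
    finally show ?thesis by simp
  qed
  moreover have "reduce \<phi> \<in> instances (SCSP B)" if "wf_formula B' \<phi>" for \<phi>
    using reduce_wf[OF that] by (simp add: SCSP_def case_prod_unfold)
  ultimately show ?thesis
    unfolding polytime_reducible_def
    by (intro exI[of _ reduce]) (simp add: CSP_def SCSP_def)
qed

end

theorem theorem3p6:
  fixes B :: "'b struct" and bs :: "'b list"
  assumes "finite_struct B"
    and "card (univ B) \<ge> 2"
    and "distinct bs" and "set bs = univ B"
    and "diagonal_cautious (univ B) bs (polymorphisms B)"
  shows "(\<exists>(D :: nat set) (F :: (nat, 'b) emap set).
            finite D \<and> encoding B D F \<and> (\<forall>(k, f) \<in> F. k \<le> 1) \<and>
            F_stable B D F \<and>
            (\<exists>f\<^sub>x. (1, f\<^sub>x) \<in> F \<and> (\<lambda>d. f\<^sub>x [d]) ` D = univ B \<and>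
               (\<forall>(k, Q) \<in> set (rels B).
                  F_induced B D F k (\<Union>q \<in> Q. listset (map (\<lambda>b. {d \<in> D. f\<^sub>x [d] = b}) q)))))
         \<and> polytime_reducible (CSP (expand_constants B bs)) (SCSP B)"
proof
  interpret reduction B bs
    using assms by unfold_locales
  show "polytime_reducible (CSP (expand_constants B bs)) (SCSP B)"
    by (rule polytime_reducible_CSP_SCSP)
qed (rule ex_stable_encoding[OF assms(1,4,5)])

end
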